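(* Let $n,m\in\mathbb{N}$ and $0=t_0<t_1<t_2<\cdots<t_m$. Then for all $\theta_1,\dots,\theta_m\in\mathbb{R}$ the joint characteristic function of $(S^{(1,n)}_{t_1},\dots,S^{(1,n)}_{t_m})$ takes the form $$\mathbb{E}\Bigl(\exp\Bigl\{\mathrm{i}\sum_{\ell=1}^m\theta_\ell S^{(1,n)}_{t_\ell}\Bigr\}\Bigr)=\int_0^1 e^{\frac{\lambda}{1-a}K_n(a)}\,\psi(a)(1-a)^\beta\,\mathrm{d}a,$$ where, with $\theta_{j,m}:=\theta_j+\cdots+\theta_m$, $j=1,\dots,m$, for all $a\in[0,1]$, $$\begin{aligned}K_n(a):={}&\sum_{\ell=1}^m\bigl(e^{\mathrm{i}\theta_{\ell,m}}-1-\mathrm{i}\theta_{\ell,m}\bigr)\bigl(\lfloor nt_\ell\rfloor-\lfloor nt_{\ell-1}\rfloor\bigr)\\ &+\sum_{1\le\ell_1<\ell_2\le m}\ \sum_{k_1=\lfloor nt_{\ell_1-1}\rfloor+1}^{\lfloor nt_{\ell_1}\rfloor}\ \sum_{k_2=\lfloor nt_{\ell_2-1}\rfloor+1}^{\lfloor nt_{\ell_2}\rfloor}a^{k_2-k_1}\bigl(e^{\mathrm{i}\theta_{\ell_1,m}}-1\bigr)\bigl(e^{\mathrm{i}\theta_{\ell_2,m}}-1\bigr)\\ &\qquad\times e^{\mathrm{i}\bigl((\lfloor nt_{\ell_1}\rfloor-k_1)\theta_{\ell_1,m}+\sum_{\ell=\ell_1+1}^{\ell_2-1}\theta_{\ell,m}(\lfloor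 nt_\ell\rfloor-\lfloor nt_{\ell-1}\rfloor)+(k_2-1-\lfloor nt_{\ell_2-1}\rfloor)\theta_{\ell_2,m}\bigr)}\\ &+\sum_{\ell=1}^m\ \sum_{\lfloor nt_{\ell-1}\rfloor+1\le k_1<k_2\le\lfloor nt_\ell\rfloor}a^{k_2-k_1}\bigl(e^{\mathrm{i}\theta_{\ell,m}}-1\bigr)^2e^{\mathrm{i}(k_2-k_1-1)\theta_{\ell,m}}.\end{aligned}$$ Further, one also has $$\mathbb{E}\Bigl(\exp\Bigl\{\mathrm{i}\sum_{\ell=1}^m\theta_\ell S^{(1,n)}_{t_\ell}\Bigr\}\Bigr)=\int_0^1 e^{\lambda\widetilde K_n(a)}\,\psi(a)(1-a)^\beta\,\mathrm{d}a,$$ where, with $\widetilde\theta_j:=\sum_{i=1}^m\theta_i\mathbf{1}_{\{j\le\lfloor nt_i\rfloor\}}$ for $j=1,\dots,\lfloor nt_m\rfloor$, and $\widetilde\theta_{\ell,k}:=\widetilde\theta_\ell+\cdots+\widetilde\theta_k$ for $1\le\ell\le k\le\lfloor nt_m\rfloor$, for all $a\in[0,1)$, $$\begin{aligned}\widetilde K_n(a):={}&\sum_{\ell=-\infty}^{\lfloor nt_m\rfloor}\Bigl[(1-a)\sum_{k=\ell\vee1}^{\lfloor nt_m\rfloor-1}a^{k-\ell}\bigl(e^{\mathrm{i}\widetilde\theta_{\ell\vee1,k}}-1-\mathrm{i}\widetilde\theta_{\ell\vee1,k}\bigr)+a^{\lfloor nt_m\rfloor-\ell}\bigl(e^{\mathrm{i}\widetilde\theta_{\ell\vee1,\lfloor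 nt_m\rfloor}}-1-\mathrm{i}\widetilde\theta_{\ell\vee1,\lfloor nt_m\rfloor}\bigr)\Bigr]\\ ={}&\sum_{k=1}^{\lfloor nt_m\rfloor-1}a^k\bigl(e^{\mathrm{i}\widetilde\theta_{1,k}}-1-\mathrm{i}\widetilde\theta_{1,k}\bigr)+\frac{a^{\lfloor nt_m\rfloor}}{1-a}\bigl(e^{\mathrm{i}\widetilde\theta_{1,\lfloor nt_m\rfloor}}-1-\mathrm{i}\widetilde\theta_{1,\lfloor nt_m\rfloor}\bigr)\\ &+\sum_{\ell=1}^{\lfloor nt_m\rfloor}\Bigl[(1-a)\sum_{k=\ell}^{\lfloor nt_m\rfloor-1}a^{k-\ell}\bigl(e^{\mathrm{i}\widetilde\theta_{\ell,k}}-1-\mathrm{i}\widetilde\theta_{\ell,k}\bigr)+a^{\lfloor nt_m\rfloor-\ell}\bigl(e^{\mathrm{i}\widetilde\theta_{\ell,\lfloor nt_m\rfloor}}-1-\mathrm{i}\widetilde\theta_{\ell,\lfloor nt_m\rfloor}\bigr)\Bigr].\end{aligned}$$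
   Context: Notation: $\mathbb{N}=\{1,2,\dots\}$, $\mathbb{Z}_+=\{0,1,2,\dots\}$, $\mathbb{R}_+=[0,\infty)$, $\mathrm{i}$ in exponents and as a factor is the imaginary unit (in $\theta_i$, $t_i$ the letter $i$ is an index), $\lfloor\cdot\rfloor$ is the integer part, $x\vee y:=\max(x,y)$, $\mathbf{1}$ denotes an indicator, $0^0:=1$. Sums over empty index ranges are $0$; in particular, if $\lfloor nt_m\rfloor=0$ then $\widetilde\theta_{1,0}:=0$. Mixing distribution: $\alpha$ is a random variable with values in $(0,1)$ having a probability density of the form $\psi(x)(1-x)^\beta$, $x\in(0,1)$, where $\beta\in(-1,\infty)$ and $\psi$ is a function on $(0,1)$ having a limit $\lim_{x\uparrow1}\psi(x)=\psi_1\in(0,\infty)$. Randomized INAR(1) process with Poisson innovations: let $\lambda\in(0,\infty)$. On some probability space, let $\alpha$ be a random variable with values in $(0,1)$ having the probability density $\psi(x)(1-x)^\beta$, $x\in(0,1)$, where $\beta\in(-1,\infty)$ and $\lim_{x\uparrow1}\psi(x)=\psi_1\in(0,\infty)$, and let $\{X_0,\ \xi_{k,j},\ \varepsilon_k : k,j\in\mathbb{N}\}$ be random variables which are conditionally independent given $\alpha$ and satisfy, for $k,j\in\mathbb{N}$: $\mathbb{P}(\xi_{k,j}=1\mid\alpha)=\alpha=1-\mathbb{P}(\xi_{k,j}=0\mid\alpha)$; conditionally on $\alpha$, $\varepsilon_k$ is Poisson distributed with parameter $\lambda$; conditionally on $\alpha$, $X_0$ is Poisson distributed with parameter $\lambda/(1-\alpha)$.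 Define $X_k:=\sum_{j=1}^{X_{k-1}}\xi_{k,j}+\varepsilon_k$, $k\in\mathbb{N}$. Conditionally on $\alpha$, $(X_k)_{k\in\mathbb{Z}_+}$ is a strictly stationary INAR(1) process and $\mathbb{E}(X_k\mid\alpha)=\lambda/(1-\alpha)$. The process $S^{(1,n)}$ (one copy): up to equality in law of the whole process, $$S^{(1,n)}_t:=\sum_{k=1}^{\lfloor nt\rfloor}\Bigl(X_k-\frac{\lambda}{1-\alpha}\Bigr),\qquad t\in\mathbb{R}_+.$$ *)

theory Defs
  imports "HOL-Probability.Probability"
begin

definition prob_given :: "'w measure \<Rightarrow> 'w measure \<Rightarrow> 'w set \<Rightarrow> 'w \<Rightarrow> real" where
  "prob_given M F A = real_cond_exp M F (indicator A)"

text \<open>Mirrors \<^const>\<open>prob_space.indep_vars\<close>, with probabilities replaced by conditional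
  probabilities given the sub-sigma-algebra \<open>F\<close>.\<close>

definition cond_indep_vars ::
  "'w measure \<Rightarrow> 'w measure \<Rightarrow> ('i \<Rightarrow> 'b measure) \<Rightarrow> ('i \<Rightarrow> 'w \<Rightarrow> 'b) \<Rightarrow> 'i set \<Rightarrow> bool" where
  "cond_indep_vars M F N Y I \<longleftrightarrow>
     (\<forall>i\<in>I. Y i \<in> measurable M (N i)) \<and>
     (\<forall>J B. J \<subseteq> I \<and> J \<noteq> {} \<and> finite J \<and> (\<forall>j\<in>J. B j \<in> sets (N j)) \<longrightarrow>
        (AE w in M. prob_given M F {v \<in> space M. \<forall>j\<in>J. Y j v \<in> B j} w
                  = (\<Prod>j\<in>J. prob_given M F {v \<in> space M. Y j v \<in> B j} w)))"

text \<open>Labels for the joint family \<open>X\<^sub>0\<close>, \<open>\<xi>\<^sub>k\<^sub>,\<^sub>j\<close>, \<open>\<epsilon>\<^sub>k\<close>; only the indices \<open>k, j \<ge> 1\<close> are used.\<close>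

datatype inar_index = Initial | Thinning nat nat | Innovation nat

definition inar_indices :: "inar_index set" where
  "inar_indices =
     {Initial} \<union> {Thinning k j |k j. 1 \<le> k \<and> 1 \<le> j} \<union> {Innovation k |k. 1 \<le> k}"

primrec inar_family ::
  "('w \<Rightarrow> nat) \<Rightarrow> (nat \<Rightarrow> nat \<Rightarrow> 'w \<Rightarrow> nat) \<Rightarrow> (nat \<Rightarrow> 'w \<Rightarrow> nat) \<Rightarrow> inar_index \<Rightarrow> 'w \<Rightarrow> nat" where
  "inar_family X0 \<xi> \<epsilon> Initial = X0"
| "inar_family X0 \<xi> \<epsilon> (Thinning k j) = \<xi> k j"
| "inar_family X0 \<xi> \<epsilon> (Innovation k) = \<epsilon> k"

abbreviation sigma_gen :: "'w measure \<Rightarrow> ('w \<Rightarrow> real) \<Rightarrow> 'w measure" where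
  "sigma_gen M \<alpha> \<equiv> vimage_algebra (space M) \<alpha> borel"

locale randomized_poisson_inar1 = prob_space M
  for M :: "'w measure" +
  fixes lam \<beta> \<psi>1 :: real
    and \<psi> :: "real \<Rightarrow> real"
    and \<alpha> :: "'w \<Rightarrow> real"
    and X0 :: "'w \<Rightarrow> nat"
    and \<xi> :: "nat \<Rightarrow> nat \<Rightarrow> 'w \<Rightarrow> nat"
    and \<epsilon> :: "nat \<Rightarrow> 'w \<Rightarrow> nat"
  assumes lam_pos: "0 < lam"
    and beta_gt: "- 1 < \<beta>"
    and psi_nonneg: "\<And>x. x \<in> {0<..<1} \<Longrightarrow> 0 \<le> \<psi> x"
    and psi1_pos: "0 < \<psi>1"
    and psi_lim: "(\<psi> \<longlongrightarrow> \<psi>1) (at_left 1)"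
    and alpha_range: "\<And>w. w \<in> space M \<Longrightarrow> \<alpha> w \<in> {0<..<1}"
    and alpha_density:
      "distributed M lborel \<alpha>
         (\<lambda>x. ennreal (\<psi> x * (1 - x) powr \<beta> * indicator {0<..<1} x))"
    and cond_indep:
      "cond_indep_vars M (sigma_gen M \<alpha>) (\<lambda>_. count_space UNIV)
         (inar_family X0 \<xi> \<epsilon>) inar_indices"
    and thinning_1: "\<And>k j. 1 \<le> k \<Longrightarrow> 1 \<le> j \<Longrightarrow>
      AE w in M. prob_given M (sigma_gen M \<alpha>) {v \<in> space M. \<xi> k j v = 1} w = \<alpha> w"
    and thinning_0: "\<And>k j. 1 \<le> k \<Longrightarrow> 1 \<le> j \<Longrightarrow>
      AE w in M. prob_given M (sigma_gen M \<alpha>) {v \<in> space M. \<xi> k j v = 0} w = 1 - \<alpha> w"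
    and innovation: "\<And>k x. 1 \<le> k \<Longrightarrow>
      AE w in M. prob_given M (sigma_gen M \<alpha>) {v \<in> space M. \<epsilon> k v = x} w
               = pmf (poisson_pmf lam) x"
    and initial: "\<And>x.
      AE w in M. prob_given M (sigma_gen M \<alpha>) {v \<in> space M. X0 v = x} w
               = pmf (poisson_pmf (lam / (1 - \<alpha> w))) x"

primrec inar ::
  "('w \<Rightarrow> nat) \<Rightarrow> (nat \<Rightarrow> nat \<Rightarrow> 'w \<Rightarrow> nat) \<Rightarrow> (nat \<Rightarrow> 'w \<Rightarrow> nat) \<Rightarrow> nat \<Rightarrow> 'w \<Rightarrow> nat" where
  "inar X0 \<xi> \<epsilon> 0 w = X0 w"
| "inar X0 \<xi> \<epsilon> (Suc k) w = (\<Sum>j=1..inar X0 \<xi> \<epsilon> k w. \<xi> (Suc k) j w) + \<epsilon> (Suc k) w"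

definition S1 ::
  "real \<Rightarrow> ('w \<Rightarrow> real) \<Rightarrow> ('w \<Rightarrow> nat) \<Rightarrow> (nat \<Rightarrow> nat \<Rightarrow> 'w \<Rightarrow> nat) \<Rightarrow> (nat \<Rightarrow> 'w \<Rightarrow> nat)
     \<Rightarrow> nat \<Rightarrow> real \<Rightarrow> 'w \<Rightarrow> real" where
  "S1 lam \<alpha> X0 \<xi> \<epsilon> n t w =
     (\<Sum>k=1..nat \<lfloor>real n * t\<rfloor>. real (inar X0 \<xi> \<epsilon> k w) - lam / (1 - \<alpha> w))"

text \<open>Time indices are integers, so that all differences are genuine and the index
  \<open>\<ell>\<close> of \<open>Ktilde\<close> may run down to minus infinity. The exponents of \<open>powi\<close>
  below are nonnegative on the summation ranges, and \<open>0 powi 0 = 1\<close>.\<close>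

definition fl :: "nat \<Rightarrow> (nat \<Rightarrow> real) \<Rightarrow> nat \<Rightarrow> int" where
  "fl n t l = \<lfloor>real n * t l\<rfloor>"

definition tail_sum :: "(nat \<Rightarrow> real) \<Rightarrow> nat \<Rightarrow> nat \<Rightarrow> real" where
  "tail_sum \<theta> m j = (\<Sum>i=j..m. \<theta> i)"

definition K_fun :: "nat \<Rightarrow> nat \<Rightarrow> (nat \<Rightarrow> real) \<Rightarrow> (nat \<Rightarrow> real) \<Rightarrow> real \<Rightarrow> complex" where
  "K_fun n m t \<theta> a =
    (let N = fl n t; T = tail_sum \<theta> m in
      (\<Sum>l=1..m. (iexp (T l) - 1 - \<i> * of_real (T l)) * of_int (N l - N (l - 1)))
    + (\<Sum>l1=1..m. \<Sum>l2=l1+1..m. \<Sum>k1=N (l1 - 1) + 1..N l1. \<Sum>k2=N (l2 - 1) + 1..N l2.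
         of_real (a powi (k2 - k1)) * (iexp (T l1) - 1) * (iexp (T l2) - 1)
         * iexp (of_int (N l1 - k1) * T l1
                 + (\<Sum>l=l1+1..l2-1. T l * of_int (N l - N (l - 1)))
                 + of_int (k2 - 1 - N (l2 - 1)) * T l2))
    + (\<Sum>l=1..m. \<Sum>k1=N (l - 1) + 1..N l. \<Sum>k2=k1+1..N l.
         of_real (a powi (k2 - k1)) * (iexp (T l) - 1)\<^sup>2
         * iexp (of_int (k2 - k1 - 1) * T l)))"

definition theta_tilde ::
  "nat \<Rightarrow> nat \<Rightarrow> (nat \<Rightarrow> real) \<Rightarrow> (nat \<Rightarrow> real) \<Rightarrow> int \<Rightarrow> real" where
  "theta_tilde n m t \<theta> j = (\<Sum>i=1..m. \<theta> i * of_bool (j \<le> fl n t i))"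

definition theta_tilde2 ::
  "nat \<Rightarrow> nat \<Rightarrow> (nat \<Rightarrow> real) \<Rightarrow> (nat \<Rightarrow> real) \<Rightarrow> int \<Rightarrow> int \<Rightarrow> real" where
  "theta_tilde2 n m t \<theta> l k = (\<Sum>j=l..k. theta_tilde n m t \<theta> j)"

definition Ktilde_term ::
  "nat \<Rightarrow> nat \<Rightarrow> (nat \<Rightarrow> real) \<Rightarrow> (nat \<Rightarrow> real) \<Rightarrow> real \<Rightarrow> int \<Rightarrow> complex" where
  "Ktilde_term n m t \<theta> a l =
    (let N = fl n t m; T = theta_tilde2 n m t \<theta> in
      of_real (1 - a) * (\<Sum>k=max l 1..N - 1. of_real (a powi (k - l))
          * (iexp (T (max l 1) k) - 1 - \<i> * of_real (T (max l 1) k)))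
      + of_real (a powi (N - l)) * (iexp (T (max l 1) N) - 1 - \<i> * of_real (T (max l 1) N)))"

definition Ktilde :: "nat \<Rightarrow> nat \<Rightarrow> (nat \<Rightarrow> real) \<Rightarrow> (nat \<Rightarrow> real) \<Rightarrow> real \<Rightarrow> complex" where
  "Ktilde n m t \<theta> a = (\<Sum>\<^sub>\<infinity>l\<in>{..fl n t m}. Ktilde_term n m t \<theta> a l)"

definition Ktilde_closed ::
  "nat \<Rightarrow> nat \<Rightarrow> (nat \<Rightarrow> real) \<Rightarrow> (nat \<Rightarrow> real) \<Rightarrow> real \<Rightarrow> complex" where
  "Ktilde_closed n m t \<theta> a =
    (let N = fl n t m; T = theta_tilde2 n m t \<theta> in
      (\<Sum>k=1..N - 1. of_real (a powi k) * (iexp (T 1 k) - 1 - \<i> * of_real (T 1 k)))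
    + of_real (a powi N / (1 - a)) * (iexp (T 1 N) - 1 - \<i> * of_real (T 1 N))
    + (\<Sum>l=1..N.
         of_real (1 - a) * (\<Sum>k=l..N - 1. of_real (a powi (k - l))
             * (iexp (T l k) - 1 - \<i> * of_real (T l k)))
         + of_real (a powi (N - l)) * (iexp (T l N) - 1 - \<i> * of_real (T l N))))"

end

theory Submission
  imports Defs
begin

text \<open>Writing \<open>u\<^sub>k\<close> for \<open>theta_tilde n m t \<theta> k\<close>, the linear combination of the partial sums is
  \<open>\<Sum>k. u\<^sub>k * (X\<^sub>k - lam / (1 - \<alpha>))\<close>. Each variable of the family is conditionally independent
  of all the others given \<open>\<alpha>\<close>, so it can be integrated out against any bounded function that is
  measurable with respect to \<open>\<alpha>\<close> and the others. Integrating out the steps of the process from the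
  last one backwards replaces \<open>d ^ X\<^sub>k\<close> by
  \<open>exp (lam * (d - 1)) * (1 - \<alpha> + \<alpha> * d) ^ X\<^sub>k\<^sub>-\<^sub>1\<close> and ends with the Poisson law of \<open>X\<^sub>0\<close>.
  The resulting exponent satisfies a recursion in the number of steps that is affine in \<open>d - 1\<close>;
  both closed forms of the exponent satisfy the same recursion. Grouping the times into the blocks on
  which \<open>u\<close> is constant gives \<open>K_fun\<close>, and a geometric series gives \<open>Ktilde\<close>.\<close>

section \<open>Conditional independence of one variable from all the others\<close>

text \<open>No conditional measure given \<open>\<alpha> = a\<close> is constructed: the hypotheses
  speak of versions of conditional probabilities, each fixed only up to a null set. All conditioning
  is therefore turned into identities between integrals over \<open>M\<close> with a bounded test
  function. Such an identity concerns one index \<open>i\<close> and one sigma-algebra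
  \<open>sigma_avoiding i\<close>. Integrating a variable out leaves a function of
  \<open>\<alpha>\<close> behind, which is why the bases of the powers are functions of
  \<open>\<alpha>\<close> and not numbers. A second obstacle is the random number of summands in a
  thinning step. It brings infinitely many variables into play, so they are exchanged one at a time
  and the limit is taken by bounded convergence; for this every base and every generating factor is
  kept in the closed unit disc. The same bound makes the final integrands integrable, although
  \<open>lam / (1 - a)\<close> is unbounded near \<open>a = 1\<close>.\<close>

context randomized_poisson_inar1
begin

abbreviation Y :: "inar_index \<Rightarrow> 'w \<Rightarrow> nat" where
  "Y \<equiv> inar_family X0 \<xi> \<epsilon>"

text \<open>The condition on \<open>\<alpha>\<close> belongs to each cylinder, so the generated
  sigma-algebra contains that of \<open>\<alpha>\<close>, and factors depending on
  \<open>\<alpha>\<close> are admissible test functions. Only finitely many coordinates are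
  restricted, which gives a pi-system within reach of \<open>cond_indep_vars\<close>.\<close>

definition cylinders_avoiding :: "inar_index \<Rightarrow> 'w set set" where
  "cylinders_avoiding i =
     {{w \<in> space M. \<alpha> w \<in> A \<and> (\<forall>j\<in>J. Y j w \<in> C j)} |A J C.
        A \<in> sets borel \<and> finite J \<and> J \<subseteq> inar_indices - {i}}"

definition sigma_avoiding :: "inar_index \<Rightarrow> 'w measure" where
  "sigma_avoiding i = sigma (space M) (cylinders_avoiding i)"

lemma alpha_measurable [measurable]: "\<alpha> \<in> borel_measurable M"
  using distributed_measurable[OF alpha_density] by simp

lemma Y_measurable: "j \<in> inar_indices \<Longrightarrow> Y j \<in> measurable M (count_space UNIV)"
  using cond_indep unfolding cond_indep_vars_def by blast

lemma alpha_subalgebra: "subalgebra M (sigma_gen M \<alpha>)"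
  unfolding subalgebra_def
proof safe
  fix B assume "B \<in> sets (sigma_gen M \<alpha>)"
  then show "B \<in> sets M"
    using measurable_sets[OF alpha_measurable] by (auto simp: sets_vimage_algebra2)
qed simp_all

sublocale cond_alpha: finite_measure_subalgebra M "sigma_gen M \<alpha>"
  by unfold_locales (rule alpha_subalgebra)

lemma alpha_measurable_sigma_gen: "\<alpha> \<in> borel_measurable (sigma_gen M \<alpha>)"
  by (rule measurable_vimage_algebra1) simp

lemma cylinder_measurable:
  assumes "A \<in> sets borel" "finite J" "J \<subseteq> inar_indices"
  shows "{w \<in> space M. \<alpha> w \<in> A \<and> (\<forall>j\<in>J. Y j w \<in> C j)} \<in> sets M"
proof -
  have "{w \<in> space M. Y j w \<in> C j} \<in> sets M" if "j \<in> J" for j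
    using measurable_sets[OF Y_measurable, of j "C j"] assms that
    by (auto simp: vimage_def Int_def conj_commute)
  moreover have "{w \<in> space M. \<alpha> w \<in> A} \<in> sets M"
    using measurable_sets[OF alpha_measurable assms(1)] by (simp add: vimage_def Int_def conj_commute)
  ultimately show ?thesis
    using assms(2) by (intro sets.sets_Collect) auto
qed

lemma cylinders_avoiding_in_sets: "cylinders_avoiding i \<subseteq> sets M"
  unfolding cylinders_avoiding_def using cylinder_measurable by blast

lemma cylinders_avoiding_Pow: "cylinders_avoiding i \<subseteq> Pow (space M)"
  using cylinders_avoiding_in_sets sets.sets_into_space by blast

lemma sets_sigma_avoiding: "sets (sigma_avoiding i) = sigma_sets (space M) (cylinders_avoiding i)"
  unfolding sigma_avoiding_def using cylinders_avoiding_Pow by (rule sets_measure_of)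

lemma space_sigma_avoiding [simp]: "space (sigma_avoiding i) = space M"
  unfolding sigma_avoiding_def using cylinders_avoiding_Pow by (rule space_measure_of)

lemma sigma_avoiding_subalgebra: "subalgebra M (sigma_avoiding i)"
  unfolding subalgebra_def sets_sigma_avoiding
  using sets.sigma_sets_subset[OF cylinders_avoiding_in_sets] by simp

lemma alpha_measurable_avoiding [measurable]: "\<alpha> \<in> borel_measurable (sigma_avoiding i)"
proof (rule measurableI)
  fix A :: "real set" assume "A \<in> sets borel"
  then have "{w \<in> space M. \<alpha> w \<in> A \<and> (\<forall>j\<in>{}. Y j w \<in> UNIV)} \<in> cylinders_avoiding i"
    unfolding cylinders_avoiding_def by blast
  then show "\<alpha> -` A \<inter> space (sigma_avoiding i) \<in> sets (sigma_avoiding i)"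
    unfolding sets_sigma_avoiding by (auto simp: vimage_def Int_def conj_commute)
qed simp

lemma Y_measurable_avoiding:
  assumes "j \<in> inar_indices" "j \<noteq> i"
  shows "Y j \<in> measurable (sigma_avoiding i) (count_space UNIV)"
proof (rule measurableI)
  fix D :: "nat set"
  have "{w \<in> space M. \<alpha> w \<in> UNIV \<and> (\<forall>k\<in>{j}. Y k w \<in> D)} \<in> cylinders_avoiding i"
    unfolding cylinders_avoiding_def using assms
    by (intro CollectI exI[of _ UNIV] exI[of _ "{j}"] exI[of _ "\<lambda>_. D"]) auto
  then show "Y j -` D \<inter> space (sigma_avoiding i) \<in> sets (sigma_avoiding i)"
    unfolding sets_sigma_avoiding by (auto simp: vimage_def Int_def conj_commute)
qed simp

lemma cylinders_avoiding_Int_stable: "Int_stable (cylinders_avoiding i)"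
proof (rule Int_stableI)
  fix a b assume "a \<in> cylinders_avoiding i" "b \<in> cylinders_avoiding i"
  then obtain A J C A' J' C' where
    a: "a = {w \<in> space M. \<alpha> w \<in> A \<and> (\<forall>j\<in>J. Y j w \<in> C j)}"
      "A \<in> sets borel" "finite J" "J \<subseteq> inar_indices - {i}" and
    b: "b = {w \<in> space M. \<alpha> w \<in> A' \<and> (\<forall>j\<in>J'. Y j w \<in> C' j)}"
      "A' \<in> sets borel" "finite J'" "J' \<subseteq> inar_indices - {i}"
    unfolding cylinders_avoiding_def by blast
  let ?C = "\<lambda>j. (if j \<in> J then C j else UNIV) \<inter> (if j \<in> J' then C' j else UNIV)"
  have "a \<inter> b = {w \<in> space M. \<alpha> w \<in> A \<inter> A' \<and> (\<forall>j\<in>J \<union> J'. Y j w \<in> ?C j)}"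
    unfolding a(1) b(1) by auto
  moreover have "A \<inter> A' \<in> sets borel" "finite (J \<union> J')" "J \<union> J' \<subseteq> inar_indices - {i}"
    using a(2-4) b(2-4) by auto
  ultimately show "a \<inter> b \<in> cylinders_avoiding i"
    unfolding cylinders_avoiding_def by (intro CollectI exI conjI)
qed

text \<open>Conditional independence for \<open>insert i J\<close> splits off the factor of
  \<open>i\<close>; a second use, for \<open>J\<close>, reassembles the remaining product. The empty
  \<open>J\<close> is a separate case because \<open>cond_indep_vars\<close> speaks of nonempty
  families; there the first factor is the conditional probability of the whole space, which is 1
  almost everywhere.\<close>

lemma prob_given_factor:
  assumes i: "i \<in> inar_indices" and J: "finite J" "J \<subseteq> inar_indices - {i}"
  shows "AE w in M. prob_given M (sigma_gen M \<alpha>)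
             {v \<in> space M. (\<forall>j\<in>J. Y j v \<in> C j) \<and> Y i v \<in> D} w
           = prob_given M (sigma_gen M \<alpha>) {v \<in> space M. \<forall>j\<in>J. Y j v \<in> C j} w
           * prob_given M (sigma_gen M \<alpha>) {v \<in> space M. Y i v \<in> D} w"
proof (cases "J = {}")
  case True
  have "AE w in M. real_cond_exp M (sigma_gen M \<alpha>) (indicator (space M)) w = indicator (space M) w"
  proof (rule cond_alpha.real_cond_exp_F_meas)
    have "space M \<in> sets (sigma_gen M \<alpha>)"
      using sets.top[of "sigma_gen M \<alpha>"] by simp
    then show "indicator (space M) \<in> borel_measurable (sigma_gen M \<alpha>)"
      by (rule borel_measurable_indicator)
  qed (simp add: emeasure_space_1)
  with True AE_space show ?thesis
    by (auto simp: prob_given_def)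
next
  case False
  have CI: "AE w in M. prob_given M (sigma_gen M \<alpha>) {v \<in> space M. \<forall>j\<in>J. Y j v \<in> B j} w
                  = (\<Prod>j\<in>J. prob_given M (sigma_gen M \<alpha>) {v \<in> space M. Y j v \<in> B j} w)"
    if "J \<subseteq> inar_indices" "J \<noteq> {}" "finite J" for J B
    using cond_indep that unfolding cond_indep_vars_def by simp
  let ?B = "C(i := D)"
  have "i \<notin> J" using J by auto
  have eq1: "{v \<in> space M. \<forall>j\<in>insert i J. Y j v \<in> ?B j} =
      {v \<in> space M. (\<forall>j\<in>J. Y j v \<in> C j) \<and> Y i v \<in> D}"
    and eq2: "{v \<in> space M. \<forall>j\<in>J. Y j v \<in> ?B j} = {v \<in> space M. \<forall>j\<in>J. Y j v \<in> C j}"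
    using \<open>i \<notin> J\<close> by (auto simp: fun_upd_def)
  have "AE w in M. prob_given M (sigma_gen M \<alpha>) {v \<in> space M. \<forall>j\<in>insert i J. Y j v \<in> ?B j} w
      = (\<Prod>j\<in>insert i J. prob_given M (sigma_gen M \<alpha>) {v \<in> space M. Y j v \<in> ?B j} w)"
    using i J by (intro CI) auto
  moreover have "AE w in M. prob_given M (sigma_gen M \<alpha>) {v \<in> space M. \<forall>j\<in>J. Y j v \<in> ?B j} w
      = (\<Prod>j\<in>J. prob_given M (sigma_gen M \<alpha>) {v \<in> space M. Y j v \<in> ?B j} w)"
    using False J by (intro CI) auto
  ultimately show ?thesis
    unfolding eq1 eq2 using \<open>finite J\<close> \<open>i \<notin> J\<close> by (auto simp: mult.commute)
qed

text \<open>This is the defining identity of the conditional expectation given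
  \<open>sigma_avoiding i\<close>, tested on the generator. The condition on \<open>\<alpha>\<close>
  is pulled out and the conditional probability of the remaining event factors. Once the factor of
  \<open>i\<close> has become \<open>p (\<alpha> w)\<close>, a function of \<open>\<alpha>\<close>,
  the conditioning of the other factor is undone.\<close>

lemma integral_cylinder:
  fixes p :: "real \<Rightarrow> real"
  assumes i: "i \<in> inar_indices"
    and p: "p \<in> borel_measurable borel" "\<And>a. a \<in> {0<..<1} \<Longrightarrow> \<bar>p a\<bar> \<le> 1"
    and cond: "AE w in M. prob_given M (sigma_gen M \<alpha>) {v \<in> space M. Y i v = y} w = p (\<alpha> w)"
    and B: "B \<in> cylinders_avoiding i"
  shows "(LINT w:B|M. indicator {v \<in> space M. Y i v = y} w) = (LINT w:B|M. p (\<alpha> w))"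
proof -
  note [measurable] = p(1)
  obtain A J C where B: "B = {w \<in> space M. \<alpha> w \<in> A \<and> (\<forall>j\<in>J. Y j w \<in> C j)}"
    and A [measurable]: "A \<in> sets borel" and J: "finite J" "J \<subseteq> inar_indices - {i}"
    using B unfolding cylinders_avoiding_def by blast
  let ?F = "sigma_gen M \<alpha>"
  let ?E = "{v \<in> space M. \<forall>j\<in>J. Y j v \<in> C j}" and ?H = "{v \<in> space M. Y i v = y}"
  let ?G = "{v \<in> space M. (\<forall>j\<in>J. Y j v \<in> C j) \<and> Y i v \<in> {y}}"
  have E [measurable]: "?E \<in> sets M"
    using cylinder_measurable[of UNIV J C] J by auto
  have H [measurable]: "?H \<in> sets M"
    using cylinder_measurable[of UNIV "{i}" "\<lambda>_. {y}"] i by auto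
  have G_eq: "?G = ?E \<inter> ?H" by auto
  have G [measurable]: "?G \<in> sets M" unfolding G_eq by measurable
  have [measurable]: "(\<lambda>w. indicator A (\<alpha> w) :: real) \<in> borel_measurable ?F"
    "(\<lambda>w. p (\<alpha> w)) \<in> borel_measurable ?F"
    using alpha_measurable_sigma_gen by measurable
  have p_bound: "w \<in> space M \<Longrightarrow> \<bar>p (\<alpha> w)\<bar> \<le> 1" for w
    using p(2) alpha_range by blast
  have "(LINT w:B|M. indicator ?H w) = (LINT w|M. indicator A (\<alpha> w) * indicator ?G w :: real)"
    unfolding set_lebesgue_integral_def B by (intro Bochner_Integration.integral_cong)
      (auto split: split_indicator)
  also have "\<dots> = (LINT w|M. indicator A (\<alpha> w) * real_cond_exp M ?F (indicator ?G) w)"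
    by (intro cond_alpha.real_cond_exp_intg(2)[symmetric]
        integrable_const_bound[where B = 1] AE_I2) (auto split: split_indicator)
  also have "\<dots> = (LINT w|M. indicator A (\<alpha> w) * p (\<alpha> w) * real_cond_exp M ?F (indicator ?E) w)"
  proof (intro integral_cong_AE)
    show "AE w in M. indicator A (\<alpha> w) * real_cond_exp M ?F (indicator ?G) w
       = indicator A (\<alpha> w) * p (\<alpha> w) * real_cond_exp M ?F (indicator ?E) w"
      using prob_given_factor[OF i J, of C "{y}"] cond
      by eventually_elim (simp add: prob_given_def)
  qed measurable
  also have "\<dots> = (LINT w|M. indicator A (\<alpha> w) * p (\<alpha> w) * indicator ?E w)"
    by (intro cond_alpha.real_cond_exp_intg(2)
        integrable_const_bound[where B = 1] AE_I2) (auto simp: p_bound split: split_indicator)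
  also have "\<dots> = (LINT w:B|M. p (\<alpha> w))"
    unfolding set_lebesgue_integral_def B by (intro Bochner_Integration.integral_cong)
      (auto split: split_indicator)
  finally show ?thesis .
qed

text \<open>Both sides of the characterising identity are countably additive in \<open>B\<close>, so
  it extends from the pi-system of cylinders to \<open>sigma_avoiding i\<close> by Dynkin's
  argument. The outcome is that knowing all other variables besides \<open>\<alpha>\<close> does not
  change the conditional law of \<open>Y i\<close>.\<close>

lemma sigma_avoiding_cond_exp:
  fixes p :: "real \<Rightarrow> real"
  assumes i: "i \<in> inar_indices"
    and p: "p \<in> borel_measurable borel" "\<And>a. a \<in> {0<..<1} \<Longrightarrow> \<bar>p a\<bar> \<le> 1"
    and cond: "AE w in M. prob_given M (sigma_gen M \<alpha>) {v \<in> space M. Y i v = y} w = p (\<alpha> w)"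
  shows "AE w in M. real_cond_exp M (sigma_avoiding i) (indicator {v \<in> space M. Y i v = y}) w = p (\<alpha> w)"
proof -
  interpret S: finite_measure_subalgebra M "sigma_avoiding i"
    by unfold_locales (rule sigma_avoiding_subalgebra)
  note [measurable] = p(1)
  let ?H = "{v \<in> space M. Y i v = y}"
  have H [measurable]: "?H \<in> sets M"
    using cylinder_measurable[of UNIV "{i}" "\<lambda>_. {y}"] i by auto
  have p_bound: "w \<in> space M \<Longrightarrow> \<bar>p (\<alpha> w)\<bar> \<le> 1" for w
    using p(2) alpha_range by blast
  have intH: "integrable M (indicator ?H :: _ \<Rightarrow> real)"
    by (intro integrable_const_bound[where B = 1] AE_I2) auto
  have intp: "integrable M (\<lambda>w. p (\<alpha> w))"
    by (intro integrable_const_bound[where B = 1] AE_I2) (auto simp: p_bound)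
  show ?thesis
  proof (rule S.real_cond_exp_charact)
    fix B assume "B \<in> sets (sigma_avoiding i)"
    then have "B \<in> sigma_sets (space M) (cylinders_avoiding i)"
      unfolding sets_sigma_avoiding .
    with cylinders_avoiding_Int_stable cylinders_avoiding_Pow
    show "(LINT w:B|M. indicator ?H w) = (LINT w:B|M. p (\<alpha> w))"
    proof (induction rule: sigma_sets_induct_disjoint)
      case (basic B)
      then show ?case
        using integral_cylinder[OF i p cond] by simp
    next
      case empty
      then show ?case by (simp add: set_lebesgue_integral_def)
    next
      case (compl B)
      \<comment> \<open>The empty index set makes the whole space a cylinder, so a complement is
        handled by subtraction.\<close>
      have sp: "space M \<in> cylinders_avoiding i"
        unfolding cylinders_avoiding_def
        by (intro CollectI exI[of _ UNIV] exI[of _ "{}"]) auto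
      have B [measurable]: "B \<in> sets M"
        using compl(1) sigma_avoiding_subalgebra[of i] sets_sigma_avoiding[of i]
        by (auto simp: subalgebra_def)
      have diff: "(LINT w:space M - B|M. f w) = (LINT w:space M|M. f w) - (LINT w:B|M. f w)"
        if f: "integrable M f" for f :: "'w \<Rightarrow> real"
      proof -
        have *: "set_integrable M D f" if "D \<in> sets M" for D
          using integrable_mult_indicator[OF that f] by (simp add: set_integrable_def)
        have "(LINT w:(space M - B) \<union> B|M. f w) = (LINT w:space M - B|M. f w) + (LINT w:B|M. f w)"
          by (rule set_integral_Un) (auto intro!: *)
        moreover have "space M - B \<union> B = space M"
          using sets.sets_into_space[OF B] by auto
        ultimately show ?thesis by simp
      qed
      show ?case
        using compl(2) integral_cylinder[OF i p cond sp] by (simp add: diff intH intp)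
    next
      case (union D)
      have D [measurable]: "D k \<in> sets M" for k
        using union(2) sigma_avoiding_subalgebra[of i] sets_sigma_avoiding[of i]
        by (auto simp: subalgebra_def)
      have *: "(LINT w:(\<Union>k. D k)|M. f w) = (\<Sum>k. (LINT w:D k|M. f w))"
        if f: "integrable M f" for f :: "'w \<Rightarrow> real"
      proof (rule lebesgue_integral_countable_add)
        show "set_integrable M (\<Union>k. D k) f"
          using integrable_mult_indicator[OF _ f, of "\<Union>k. D k"] by (simp add: set_integrable_def)
        show "D k \<inter> D l = {}" if "k \<noteq> l" for k l
          using union(1) that by (auto simp: disjoint_family_on_def)
      qed simp
      show ?case
        using union(3) by (simp add: * intH intp)
    qed
  qed (use intH intp in \<open>auto\<close>)
qed

text \<open>Conditional independence enters all later integrations in this form. Since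
  \<open>real_cond_exp\<close> acts on real functions, the complex \<open>V\<close> is split into
  its real and imaginary parts.\<close>

lemma integral_mult_avoiding:
  fixes p :: "real \<Rightarrow> real" and V :: "'w \<Rightarrow> complex"
  assumes i: "i \<in> inar_indices"
    and p: "p \<in> borel_measurable borel" "\<And>a. a \<in> {0<..<1} \<Longrightarrow> \<bar>p a\<bar> \<le> 1"
    and cond: "AE w in M. prob_given M (sigma_gen M \<alpha>) {v \<in> space M. Y i v = y} w = p (\<alpha> w)"
    and V: "V \<in> borel_measurable (sigma_avoiding i)" "\<And>w. w \<in> space M \<Longrightarrow> norm (V w) \<le> c"
  shows "(LINT w|M. V w * of_bool (Y i w = y)) = (LINT w|M. V w * of_real (p (\<alpha> w)))"
proof -
  interpret S: finite_measure_subalgebra M "sigma_avoiding i"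
    by unfold_locales (rule sigma_avoiding_subalgebra)
  note [measurable] = p(1)
  let ?H = "{v \<in> space M. Y i v = y}"
  have H [measurable]: "?H \<in> sets M"
    using cylinder_measurable[of UNIV "{i}" "\<lambda>_. {y}"] i by auto
  have [measurable]: "V \<in> borel_measurable M"
    using measurable_from_subalg[OF sigma_avoiding_subalgebra V(1)] .
  have p_bound: "w \<in> space M \<Longrightarrow> \<bar>p (\<alpha> w)\<bar> \<le> 1" for w
    using p(2) alpha_range by blast
  have c: "0 \<le> c"
    using V(2) not_empty norm_ge_zero order_trans by blast
  have real: "(LINT w|M. U w * indicator ?H w) = (LINT w|M. U w * p (\<alpha> w))"
    if U: "U \<in> borel_measurable (sigma_avoiding i)" "\<And>w. w \<in> space M \<Longrightarrow> \<bar>U w\<bar> \<le> c"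
    for U :: "'w \<Rightarrow> real"
  proof -
    have [measurable]: "U \<in> borel_measurable M"
      using measurable_from_subalg[OF sigma_avoiding_subalgebra U(1)] .
    have "(LINT w|M. U w * indicator ?H w)
        = (LINT w|M. U w * real_cond_exp M (sigma_avoiding i) (indicator ?H) w)"
      by (intro S.real_cond_exp_intg(2)[symmetric] U
          integrable_const_bound[where B = c] AE_I2)
        (auto simp: U(2) c split: split_indicator)
    also have "\<dots> = (LINT w|M. U w * p (\<alpha> w))"
      using sigma_avoiding_cond_exp[OF i p cond] by (intro integral_cong_AE) auto
    finally show ?thesis .
  qed
  have int1: "integrable M (\<lambda>w. V w * of_bool (Y i w = y))"
  proof (rule Bochner_Integration.integrable_cong[THEN iffD1, OF refl])
    show "integrable M (\<lambda>w. V w * indicator ?H w)"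
      by (intro integrable_const_bound[where B = c] AE_I2)
        (auto simp: norm_mult V(2) c split: split_indicator)
  qed (auto split: split_indicator)
  have int2: "integrable M (\<lambda>w. V w * of_real (p (\<alpha> w)))"
  proof (intro integrable_const_bound[where B = "c * 1"] AE_I2)
    fix w assume "w \<in> space M"
    then show "norm (V w * of_real (p (\<alpha> w))) \<le> c * 1"
      unfolding norm_mult using V(2) p_bound
      by (intro mult_mono) (auto simp: c)
  qed simp
  have 1: "(LINT w|M. Re (V w) * of_bool (Y i w = y)) = (LINT w|M. Re (V w) * indicator ?H w)"
    "(LINT w|M. Im (V w) * of_bool (Y i w = y)) = (LINT w|M. Im (V w) * indicator ?H w)"
    by (auto intro!: Bochner_Integration.integral_cong split: split_indicator)
  have of_bool [simp]: "Re (of_bool b) = of_bool b" "Im (of_bool b) = 0" for b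
    by (cases b; simp)+
  have 2: "\<bar>Re (V w)\<bar> \<le> c" "\<bar>Im (V w)\<bar> \<le> c" if "w \<in> space M" for w
    using V(2)[OF that] abs_Re_le_cmod[of "V w"] abs_Im_le_cmod[of "V w"] by linarith+
  show ?thesis
  proof (rule complex_eqI)
    show "Re (LINT w|M. V w * of_bool (Y i w = y)) = Re (LINT w|M. V w * of_real (p (\<alpha> w)))"
      using real[of "\<lambda>w. Re (V w)"] V(1) 1 2 by (simp add: integral_Re[symmetric] int1 int2)
    show "Im (LINT w|M. V w * of_bool (Y i w = y)) = Im (LINT w|M. V w * of_real (p (\<alpha> w)))"
      using real[of "\<lambda>w. Im (V w)"] V(1) 1 2 by (simp add: integral_Im[symmetric] int1 int2)
  qed
qed

end

section \<open>Generating functionals of the process\<close>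

lemma (in finite_measure) integral_bounded_convergence:
  fixes f :: "'a \<Rightarrow> 'b :: {banach, second_countable_topology}"
  assumes "\<And>n. s n \<in> borel_measurable M" "f \<in> borel_measurable M"
    and "\<And>w. w \<in> space M \<Longrightarrow> (\<lambda>n. s n w) \<longlonglongrightarrow> f w"
    and "\<And>n w. w \<in> space M \<Longrightarrow> norm (s n w) \<le> c"
  shows "(\<lambda>n. integral\<^sup>L M (s n)) \<longlonglongrightarrow> integral\<^sup>L M f"
  using assms by (intro integral_dominated_convergence[where w = "\<lambda>_. c"] AE_I2) auto

lemma measurable_count_space_sum:
  fixes f :: "'i \<Rightarrow> 'a \<Rightarrow> nat"
  assumes "\<And>i. i \<in> A \<Longrightarrow> f i \<in> measurable N (count_space UNIV)"
  shows "(\<lambda>w. \<Sum>i\<in>A. f i w) \<in> measurable N (count_space UNIV)"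
  using assms
proof (induction A rule: infinite_finite_induct)
  case (insert i A)
  then have [measurable]: "f i \<in> measurable N (count_space UNIV)"
    "(\<lambda>w. \<Sum>i\<in>A. f i w) \<in> measurable N (count_space UNIV)"
    by auto
  have "(\<lambda>w. f i w + (\<Sum>i\<in>A. f i w)) \<in> measurable N (count_space UNIV)"
    by measurable
  with insert show ?case by simp
qed simp_all

lemma measurable_random_power:
  fixes f :: "'a \<Rightarrow> complex"
  assumes [measurable]: "f \<in> borel_measurable N" "X \<in> measurable N (count_space UNIV)"
  shows "(\<lambda>w. f w ^ (X w :: nat)) \<in> borel_measurable N"
  by (rule measurable_compose_countable[where f = "\<lambda>n w. f w ^ n"]) measurable

lemma poisson_pgf_sums:
  fixes z :: complex
  assumes "0 < r"
  shows "(\<lambda>k. z ^ k * of_real (pmf (poisson_pmf r) k)) sums exp (of_real r * (z - 1))"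
proof -
  have "(\<lambda>k. exp (- of_real r) * ((z * of_real r) ^ k /\<^sub>R fact k)) sums
      (exp (- of_real r) * exp (z * of_real r))"
    by (intro sums_mult exp_converges)
  moreover have "exp (- of_real r) * exp (z * of_real r) = exp (of_real r * (z - 1))"
    unfolding exp_add[symmetric] by (simp add: algebra_simps)
  moreover have "exp (- of_real r) * ((z * of_real r) ^ k /\<^sub>R fact k)
      = z ^ k * of_real (pmf (poisson_pmf r) k)" for k
    using assms by (simp add: exp_of_real[symmetric] power_mult_distrib scaleR_conv_of_real
        field_simps)
  ultimately show ?thesis by simp
qed

lemma norm_convex_combination_le_1:
  fixes z :: complex
  assumes "0 \<le> a" "a \<le> 1" "norm z \<le> 1"
  shows "norm (1 - of_real a + of_real a * z) \<le> 1"
proof -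
  have "norm (1 - of_real a + of_real a * z) \<le> norm (of_real (1 - a) :: complex) + norm (of_real a * z)"
    using norm_triangle_ineq[of "of_real (1 - a)" "of_real a * z"] by simp
  also have "\<dots> = (1 - a) + a * norm z"
    using assms unfolding norm_mult norm_of_real by simp
  also have "\<dots> \<le> 1"
    using mult_left_mono[OF assms(3,1)] by simp
  finally show ?thesis .
qed

lemma norm_exp_of_real_mult_diff_le_1:
  fixes z :: complex
  assumes "0 \<le> r" "norm z \<le> 1"
  shows "norm (exp (of_real r * (z - 1))) \<le> 1"
  using assms complex_Re_le_cmod[of z] by (simp add: mult_nonneg_nonpos)

text \<open>The step at which a variable enters the recursion. The process at time \<open>k\<close>
  depends only on \<open>\<alpha>\<close> and variables of time at most \<open>k\<close>, so
  \<open>k < inar_time i\<close> makes it measurable for \<open>sigma_avoiding i\<close>.\<close>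

primrec inar_time :: "inar_index \<Rightarrow> nat" where
  "inar_time Initial = 0"
| "inar_time (Thinning k j) = k"
| "inar_time (Innovation k) = k"

text \<open>Given \<open>\<alpha> = a\<close>, the conditional expectation of \<open>(\<Prod>j=1..N. c j ^ X\<^sub>j) * d ^ X\<^sub>N\<close> is
  \<open>exp (lam * inar_cumulant c N a d)\<close>: integrating out step \<open>N\<close> turns \<open>d\<close> into
  \<open>1 - a + a * (c N * d)\<close> and contributes the Poisson factor of the innovation.\<close>

primrec inar_cumulant :: "(nat \<Rightarrow> complex) \<Rightarrow> nat \<Rightarrow> real \<Rightarrow> complex \<Rightarrow> complex" where
  "inar_cumulant c 0 a d = (d - 1) / of_real (1 - a)"
| "inar_cumulant c (Suc N) a d =
     (c (Suc N) * d - 1) + inar_cumulant c N a (1 - of_real a + of_real a * (c (Suc N) * d))"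

context randomized_poisson_inar1
begin

abbreviation X :: "nat \<Rightarrow> 'w \<Rightarrow> nat" where
  "X \<equiv> inar X0 \<xi> \<epsilon>"

lemma inar_indices_simps [simp]:
  "Initial \<in> inar_indices"
  "Thinning k j \<in> inar_indices \<longleftrightarrow> 1 \<le> k \<and> 1 \<le> j"
  "Innovation k \<in> inar_indices \<longleftrightarrow> 1 \<le> k"
  unfolding inar_indices_def by auto

text \<open>The power is expanded over the value \<open>y\<close> of \<open>Y i\<close>, and each
  value is exchanged by \<open>integral_mult_avoiding\<close>. Bounded convergence then applies to
  the partial sums on both sides: on the left at most one summand is nonzero, on the right the
  Poisson weights add up to at most 1. The parameter \<open>r\<close> is a function because
  \<open>X0\<close> has the parameter \<open>lam / (1 - \<alpha>)\<close>.\<close>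

lemma integral_poisson_pgf:
  fixes r :: "real \<Rightarrow> real" and V :: "'w \<Rightarrow> complex" and d :: "real \<Rightarrow> complex"
  assumes i: "i \<in> inar_indices"
    and r: "r \<in> borel_measurable borel" "\<And>a. a \<in> {0<..<1} \<Longrightarrow> 0 < r a"
    and cond: "\<And>y. AE w in M. prob_given M (sigma_gen M \<alpha>) {v \<in> space M. Y i v = y} w
                 = pmf (poisson_pmf (r (\<alpha> w))) y"
    and d: "d \<in> borel_measurable borel" "\<And>a. a \<in> {0<..<1} \<Longrightarrow> norm (d a) \<le> 1"
    and V: "V \<in> borel_measurable (sigma_avoiding i)" "\<And>w. w \<in> space M \<Longrightarrow> norm (V w) \<le> C"
  shows "(LINT w|M. V w * d (\<alpha> w) ^ Y i w)
       = (LINT w|M. V w * exp (of_real (r (\<alpha> w)) * (d (\<alpha> w) - 1)))"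
proof -
  note [measurable] = r(1) d(1) V(1) Y_measurable[OF i]
  have [measurable]: "V \<in> borel_measurable M"
    using measurable_from_subalg[OF sigma_avoiding_subalgebra V(1)] .
  have C: "0 \<le> C"
    using V(2) not_empty norm_ge_zero order_trans by blast
  \<comment> \<open>The explicit formula is Borel measurable in \<open>a\<close> on the whole line;
    it is identified with the Poisson weight only on the unit interval, where \<open>r a\<close> is
    positive.\<close>
  let ?p = "\<lambda>y a. r a ^ y / fact y * exp (- r a)"
  have p: "?p y a = pmf (poisson_pmf (r a)) y" if "a \<in> {0<..<1}" for y a
    using r(2)[OF that] by simp
  have p_bound: "\<bar>?p y a\<bar> \<le> 1" if "a \<in> {0<..<1}" for y a
    unfolding p[OF that] by (simp add: pmf_le_1)
  have dn: "norm (d (\<alpha> w)) \<le> 1" "norm (d (\<alpha> w) ^ y) \<le> 1" if "w \<in> space M" for w y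
    using d(2)[OF alpha_range[OF that]] by (auto simp: norm_power power_le_one)
  have Vd: "norm (V w * d (\<alpha> w) ^ y) \<le> C" if "w \<in> space M" for w y
    using mult_mono[OF V(2)[OF that] dn(2)[OF that]] C by (simp add: norm_mult)
  have one: "(LINT w|M. V w * d (\<alpha> w) ^ y * of_bool (Y i w = y))
      = (LINT w|M. V w * d (\<alpha> w) ^ y * of_real (?p y (\<alpha> w)))" for y
  proof (rule integral_mult_avoiding[OF i])
    show "AE w in M. prob_given M (sigma_gen M \<alpha>) {v \<in> space M. Y i v = y} w = ?p y (\<alpha> w)"
      using cond[of y] AE_space by eventually_elim (simp only: p[OF alpha_range])
  qed (use Vd p_bound in \<open>auto\<close>)
  have meas1: "(\<lambda>w. V w * d (\<alpha> w) ^ y * of_bool (Y i w = y)) \<in> borel_measurable M" for y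
    by measurable
  have meas2: "(\<lambda>w. V w * d (\<alpha> w) ^ y * of_real (?p y (\<alpha> w))) \<in> borel_measurable M" for y
    by measurable
  have int1: "integrable M (\<lambda>w. V w * d (\<alpha> w) ^ y * of_bool (Y i w = y))" for y
    by (intro integrable_const_bound[where B = C] AE_I2 meas1)
      (use Vd C in \<open>auto simp: of_bool_def\<close>)
  have int2: "integrable M (\<lambda>w. V w * d (\<alpha> w) ^ y * of_real (?p y (\<alpha> w)))" for y
  proof (intro integrable_const_bound[where B = "C * 1"] AE_I2 meas2)
    fix w assume w: "w \<in> space M"
    have "norm (V w * d (\<alpha> w) ^ y) * \<bar>?p y (\<alpha> w)\<bar> \<le> C * 1"
      by (intro mult_mono Vd w p_bound alpha_range C) auto
    then show "norm (V w * d (\<alpha> w) ^ y * of_real (?p y (\<alpha> w))) \<le> C * 1"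
      unfolding norm_mult norm_of_real .
  qed
  have sums: "(LINT w|M. (\<Sum>y<n. V w * d (\<alpha> w) ^ y * of_bool (Y i w = y)))
     = (LINT w|M. (\<Sum>y<n. V w * d (\<alpha> w) ^ y * of_real (?p y (\<alpha> w))))" for n
    using int1 int2 one by (simp add: Bochner_Integration.integral_sum del: sum_mult_of_bool_eq sum_of_bool_mult_eq)
  have sum_of_bool: "(\<Sum>y<n. V w * d (\<alpha> w) ^ y * of_bool (Y i w = y))
      = (if Y i w < n then V w * d (\<alpha> w) ^ Y i w else 0)" for w n
  proof -
    have "(\<Sum>y<n. V w * d (\<alpha> w) ^ y * of_bool (Y i w = y))
       = (\<Sum>y<n. if Y i w = y then V w * d (\<alpha> w) ^ y else 0)"
      by (intro sum.cong) auto
    then show ?thesis by simp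
  qed
  have "(\<lambda>n. LINT w|M. (\<Sum>y<n. V w * d (\<alpha> w) ^ y * of_bool (Y i w = y)))
      \<longlonglongrightarrow> (LINT w|M. V w * d (\<alpha> w) ^ Y i w)"
  proof (rule integral_bounded_convergence)
    show "(\<lambda>w. V w * d (\<alpha> w) ^ Y i w) \<in> borel_measurable M"
      by (intro borel_measurable_times measurable_random_power) measurable
    show "(\<lambda>n. \<Sum>y<n. V w * d (\<alpha> w) ^ y * of_bool (Y i w = y)) \<longlonglongrightarrow> V w * d (\<alpha> w) ^ Y i w" for w
      unfolding sum_of_bool
      by (rule tendsto_eventually, rule eventually_mono[OF eventually_gt_at_top[of "Y i w"]]) simp
    show "norm (\<Sum>y<n. V w * d (\<alpha> w) ^ y * of_bool (Y i w = y)) \<le> C" if "w \<in> space M" for n w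
      unfolding sum_of_bool using Vd[OF that] C by auto
  qed (intro borel_measurable_sum meas1)
  moreover have "(\<lambda>n. LINT w|M. (\<Sum>y<n. V w * d (\<alpha> w) ^ y * of_real (?p y (\<alpha> w))))
      \<longlonglongrightarrow> (LINT w|M. V w * exp (of_real (r (\<alpha> w)) * (d (\<alpha> w) - 1)))"
  proof (rule integral_bounded_convergence)
    show "(\<lambda>n. \<Sum>y<n. V w * d (\<alpha> w) ^ y * of_real (?p y (\<alpha> w)))
        \<longlonglongrightarrow> V w * exp (of_real (r (\<alpha> w)) * (d (\<alpha> w) - 1))" if w: "w \<in> space M" for w
      using poisson_pgf_sums[OF r(2)[OF alpha_range[OF w]], of "d (\<alpha> w)", THEN sums_mult, of "V w"]
      unfolding p[OF alpha_range[OF w]] sums_def by (simp only: mult.assoc)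
    show "norm (\<Sum>y<n. V w * d (\<alpha> w) ^ y * of_real (?p y (\<alpha> w))) \<le> C * 1"
      if w: "w \<in> space M" for n w
    proof -
      have "norm (\<Sum>y<n. V w * d (\<alpha> w) ^ y * of_real (?p y (\<alpha> w)))
          \<le> (\<Sum>y<n. C * pmf (poisson_pmf (r (\<alpha> w))) y)"
        unfolding p[OF alpha_range[OF w]]
        by (intro sum_norm_le) (simp only: norm_mult[of "_ * _" "of_real _"] norm_of_real
            abs_of_nonneg[OF pmf_nonneg] mult_right_mono[OF Vd[OF w] pmf_nonneg])
      also have "\<dots> = C * measure (measure_pmf (poisson_pmf (r (\<alpha> w)))) {..<n}"
        by (simp only: sum_distrib_left measure_measure_pmf_finite finite_lessThan)
      also have "\<dots> \<le> C * 1"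
        using C by (intro mult_left_mono) auto
      finally show ?thesis .
    qed
    show "(\<lambda>w. \<Sum>y<n. V w * d (\<alpha> w) ^ y * of_real (?p y (\<alpha> w))) \<in> borel_measurable M" for n
      by (intro borel_measurable_sum meas2)
    show "(\<lambda>w. V w * exp (of_real (r (\<alpha> w)) * (d (\<alpha> w) - 1))) \<in> borel_measurable M"
      by measurable
  qed
  ultimately show ?thesis
    unfolding sums using LIMSEQ_unique by blast
qed

text \<open>The model prescribes only the conditional probabilities of the values 0 and 1. Their
  integrals add up to 1, so no mass is left for other values.\<close>

lemma thinning_AE_01:
  assumes "1 \<le> k" "1 \<le> j"
  shows "AE w in M. \<xi> k j w = 0 \<or> \<xi> k j w = 1"
proof -
  have i: "Thinning k j \<in> inar_indices" using assms by simp
  let ?A = "\<lambda>y. {w \<in> space M. \<xi> k j w = y}"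
  have [measurable]: "\<xi> k j \<in> measurable M (count_space UNIV)"
    using Y_measurable[OF i] by simp
  have m: "?A y \<in> events" for y by measurable
  have P: "prob (?A y) = (LINT w|M. prob_given M (sigma_gen M \<alpha>) (?A y) w)" for y
    unfolding prob_given_def
    by (subst cond_alpha.real_cond_exp_int(2)) (auto intro!: integrable_real_indicator simp: m less_top[symmetric])
  have "integrable M \<alpha>"
    by (rule integrable_const_bound[where B = 1], rule AE_I2, drule alpha_range) auto
  moreover have "prob (?A 0) = (LINT w|M. 1 - \<alpha> w)" "prob (?A 1) = (LINT w|M. \<alpha> w)"
    unfolding P by (intro integral_cong_AE; use thinning_0[OF assms] thinning_1[OF assms] in
        \<open>simp add: prob_given_def\<close>)+
  ultimately have "prob (?A 0) + prob (?A 1) = 1"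
    by (simp add: prob_space)
  then have "prob (?A 0 \<union> ?A 1) = 1"
    by (subst finite_measure_Union) (auto simp: m)
  from AE_prob_1[OF this] show ?thesis by eventually_elim auto
qed

lemma integral_thinning_pgf:
  fixes V :: "'w \<Rightarrow> complex" and d :: "real \<Rightarrow> complex"
  assumes kj: "1 \<le> k" "1 \<le> j"
    and d: "d \<in> borel_measurable borel" "\<And>a. a \<in> {0<..<1} \<Longrightarrow> norm (d a) \<le> 1"
    and V: "V \<in> borel_measurable (sigma_avoiding (Thinning k j))"
      "\<And>w. w \<in> space M \<Longrightarrow> norm (V w) \<le> C"
  shows "(LINT w|M. V w * d (\<alpha> w) ^ \<xi> k j w)
       = (LINT w|M. V w * (1 - of_real (\<alpha> w) + of_real (\<alpha> w) * d (\<alpha> w)))"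
proof -
  let ?i = "Thinning k j"
  have i: "?i \<in> inar_indices" using kj by simp
  note [measurable] = d(1) V(1)
  have [measurable]: "\<xi> k j \<in> measurable M (count_space UNIV)"
    using Y_measurable[OF i] by simp
  have [measurable]: "V \<in> borel_measurable M"
    using measurable_from_subalg[OF sigma_avoiding_subalgebra V(1)] .
  have C: "0 \<le> C"
    using V(2) not_empty norm_ge_zero order_trans by blast
  have Vd: "norm (V w * d (\<alpha> w)) \<le> C" if "w \<in> space M" for w
    using mult_mono[OF V(2)[OF that] d(2)[OF alpha_range[OF that]]] C by (simp add: norm_mult)
  have a: "\<bar>\<alpha> w\<bar> \<le> 1" "\<bar>1 - \<alpha> w\<bar> \<le> 1" if "w \<in> space M" for w
    using alpha_range[OF that] by auto
  then have n: "norm (complex_of_real (\<alpha> w)) \<le> 1" "norm (complex_of_real (1 - \<alpha> w)) \<le> 1"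
    if "w \<in> space M" for w
    using that by (simp_all only: norm_of_real)
  have int: "integrable M (\<lambda>w. U w * b w)"
    if [measurable]: "U \<in> borel_measurable M" "b \<in> borel_measurable M"
      and U: "\<And>w. w \<in> space M \<Longrightarrow> norm (U w) \<le> C" "\<And>w. w \<in> space M \<Longrightarrow> norm (b w) \<le> 1"
    for U b :: "'w \<Rightarrow> complex"
  proof (intro integrable_const_bound[where B = "C * 1"] AE_I2)
    show "norm (U w * b w) \<le> C * 1" if "w \<in> space M" for w
      unfolding norm_mult using U[OF that] C by (intro mult_mono) auto
  qed simp
  have bool_meas [measurable]: "(\<lambda>w. of_bool (\<xi> k j w = y) :: complex) \<in> borel_measurable M" for y
    by measurable
  have "(LINT w|M. V w * d (\<alpha> w) ^ \<xi> k j w)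
      = (LINT w|M. V w * of_bool (Y ?i w = 0) + V w * d (\<alpha> w) * of_bool (Y ?i w = 1))"
  proof (intro integral_cong_AE)
    show "AE w in M. V w * d (\<alpha> w) ^ \<xi> k j w
        = V w * of_bool (Y ?i w = 0) + V w * d (\<alpha> w) * of_bool (Y ?i w = 1)"
      using thinning_AE_01[OF kj] by eventually_elim auto
    show "(\<lambda>w. V w * d (\<alpha> w) ^ \<xi> k j w) \<in> borel_measurable M"
      by (intro borel_measurable_times measurable_random_power) measurable
  qed simp
  also have "\<dots> = (LINT w|M. V w * of_bool (Y ?i w = 0)) + (LINT w|M. V w * d (\<alpha> w) * of_bool (Y ?i w = 1))"
    by (intro Bochner_Integration.integral_add int[OF _ _ V(2)] int[OF _ _ Vd]) auto
  also have "(LINT w|M. V w * of_bool (Y ?i w = 0)) = (LINT w|M. V w * of_real (1 - \<alpha> w))"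
    by (rule integral_mult_avoiding[OF i, where p = "\<lambda>a. 1 - a"])
      (use thinning_0[OF kj] V in \<open>auto\<close>)
  also have "(LINT w|M. V w * d (\<alpha> w) * of_bool (Y ?i w = 1)) = (LINT w|M. V w * d (\<alpha> w) * of_real (\<alpha> w))"
    by (rule integral_mult_avoiding[OF i, where p = "\<lambda>a. a"])
      (use thinning_1[OF kj] Vd in \<open>auto\<close>)
  also have "(LINT w|M. V w * of_real (1 - \<alpha> w)) + (LINT w|M. V w * d (\<alpha> w) * of_real (\<alpha> w))
      = (LINT w|M. V w * of_real (1 - \<alpha> w) + V w * d (\<alpha> w) * of_real (\<alpha> w))"
    by (intro Bochner_Integration.integral_add[symmetric] int[OF _ _ V(2) n(2)] int[OF _ _ Vd n(1)])
      measurable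
  also have "\<dots> = (LINT w|M. V w * (1 - of_real (\<alpha> w) + of_real (\<alpha> w) * d (\<alpha> w)))"
    by (intro Bochner_Integration.integral_cong) (auto simp: algebra_simps)
  finally show ?thesis .
qed

section \<open>Integrating out one time step of the process\<close>

lemma inar_measurable_avoiding:
  "k < inar_time i \<Longrightarrow> X k \<in> measurable (sigma_avoiding i) (count_space UNIV)"
proof (induction k)
  case 0
  have "X 0 = Y Initial" by auto
  with 0 show ?case
    using Y_measurable_avoiding[of Initial i] by (cases i) auto
next
  case (Suc k)
  have [measurable]: "X k \<in> measurable (sigma_avoiding i) (count_space UNIV)"
    using Suc by simp
  have "\<xi> (Suc k) j \<in> measurable (sigma_avoiding i) (count_space UNIV)" if "1 \<le> j" for j
    using Y_measurable_avoiding[of "Thinning (Suc k) j" i] Suc(2) that by (cases i) auto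
  then have "(\<lambda>w. \<Sum>j=1..n. \<xi> (Suc k) j w) \<in> measurable (sigma_avoiding i) (count_space UNIV)" for n
    by (intro measurable_count_space_sum) auto
  then have [measurable]: "(\<lambda>w. \<Sum>j=1..X k w. \<xi> (Suc k) j w) \<in> measurable (sigma_avoiding i) (count_space UNIV)"
    by (rule measurable_compose_countable) measurable
  have [measurable]: "\<epsilon> (Suc k) \<in> measurable (sigma_avoiding i) (count_space UNIV)"
    using Y_measurable_avoiding[of "Innovation (Suc k)" i] Suc(2) by (cases i) auto
  have "(\<lambda>w. (\<Sum>j=1..X k w. \<xi> (Suc k) j w) + \<epsilon> (Suc k) w) \<in> measurable (sigma_avoiding i) (count_space UNIV)"
    by measurable
  then show ?case by simp
qed

text \<open>Here \<open>i\<close> may be a thinning variable of the step itself, provided its second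
  index is at most \<open>r\<close>: the sum starts after it. This lets the summands be integrated
  out one by one, each against the sum of those that follow.\<close>

lemma thinned_sum_measurable_avoiding:
  assumes "k < inar_time i" "\<And>j. r < j \<Longrightarrow> i \<noteq> Thinning (Suc k) j"
  shows "(\<lambda>w. \<Sum>j=Suc r..X k w. \<xi> (Suc k) j w) \<in> measurable (sigma_avoiding i) (count_space UNIV)"
proof (rule measurable_compose_countable[where g = "X k"
      and f = "\<lambda>n w. \<Sum>j=Suc r..n. \<xi> (Suc k) j w"])
  show "X k \<in> measurable (sigma_avoiding i) (count_space UNIV)"
    by (rule inar_measurable_avoiding) fact
  have "\<xi> (Suc k) j \<in> measurable (sigma_avoiding i) (count_space UNIV)" if "r < j" for j
    using Y_measurable_avoiding[of "Thinning (Suc k) j" i] assms(2)[OF that] that by auto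
  then show "(\<lambda>w. \<Sum>j=Suc r..n. \<xi> (Suc k) j w) \<in> measurable (sigma_avoiding i) (count_space UNIV)" for n
    by (intro measurable_count_space_sum) auto
qed

text \<open>The first hypothesis on \<open>V\<close> says that \<open>V\<close> depends on the past
  up to time \<open>k\<close>: it does not see any variable of a later time. Hence \<open>V\<close>
  may stay in the test function while the innovation and the thinning variables of step
  \<open>Suc k\<close> are integrated out.\<close>

lemma integral_inar_step:
  fixes V :: "'w \<Rightarrow> complex" and d :: "real \<Rightarrow> complex"
  assumes d: "d \<in> borel_measurable borel" "\<And>a. a \<in> {0<..<1} \<Longrightarrow> norm (d a) \<le> 1"
    and V: "\<And>i. k < inar_time i \<Longrightarrow> V \<in> borel_measurable (sigma_avoiding i)"
      "\<And>w. w \<in> space M \<Longrightarrow> norm (V w) \<le> C"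
  shows "(LINT w|M. V w * d (\<alpha> w) ^ X (Suc k) w)
       = (LINT w|M. V w * exp (of_real lam * (d (\<alpha> w) - 1))
            * (1 - of_real (\<alpha> w) + of_real (\<alpha> w) * d (\<alpha> w)) ^ X k w)"
proof -
  note [measurable] = d(1)
  have C: "0 \<le> C"
    using V(2) not_empty norm_ge_zero order_trans by blast
  define B where "B w = 1 - of_real (\<alpha> w) + of_real (\<alpha> w) * d (\<alpha> w)" for w
  define U where "U w = V w * exp (of_real lam * (d (\<alpha> w) - 1))" for w
  define T where "T r w = (\<Sum>j=Suc r..X k w. \<xi> (Suc k) j w)" for r w
  \<comment> \<open>The first \<open>r\<close> thinning variables of the random sum are replaced by their conditional
    generating function; the expectation does not depend on \<open>r\<close>, and \<open>r \<rightarrow> \<infinity>\<close> gives the claim.\<close>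
  define W where "W r w = U w * B w ^ min r (X k w) * d (\<alpha> w) ^ T r w" for r w
  have dn: "norm (d (\<alpha> w)) \<le> 1" if "w \<in> space M" for w
    using d(2) alpha_range that by blast
  have Bn: "norm (B w) \<le> 1" if "w \<in> space M" for w
    unfolding B_def using alpha_range[OF that] dn[OF that]
    by (intro norm_convex_combination_le_1) auto
  have mult_le: "norm (x * y) \<le> C" if "norm x \<le> C" "norm y \<le> 1" for x y :: complex
    using mult_mono[OF that] C by (simp add: norm_mult)
  have pow_le: "norm (x ^ n) \<le> 1" if "norm x \<le> 1" for x :: complex and n
    using that by (simp add: norm_power power_le_one)
  have Un: "norm (U w) \<le> C" if "w \<in> space M" for w
    unfolding U_def using lam_pos
    by (intro mult_le V(2) that norm_exp_of_real_mult_diff_le_1 dn) auto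
  have B_meas [measurable]: "B \<in> borel_measurable (sigma_avoiding i)" for i
    unfolding B_def by measurable
  have U_meas: "U \<in> borel_measurable (sigma_avoiding i)" if "k < inar_time i" for i
    unfolding U_def using V(1)[OF that] by measurable
  have Tpow_meas: "(\<lambda>w. d (\<alpha> w) ^ T r w) \<in> borel_measurable (sigma_avoiding i)"
    if "k < inar_time i" "\<And>j. r < j \<Longrightarrow> i \<noteq> Thinning (Suc k) j" for r i
    unfolding T_def
    by (intro measurable_random_power thinned_sum_measurable_avoiding that) measurable
  have Bpow_meas: "(\<lambda>w. B w ^ f (X k w)) \<in> borel_measurable (sigma_avoiding i)"
    if "k < inar_time i" for i f
    by (intro measurable_random_power measurable_compose[OF inar_measurable_avoiding[OF that]])
      measurable
  have bool_meas: "(\<lambda>w. of_bool (r < X k w) :: complex) \<in> borel_measurable (sigma_avoiding i)"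
    if "k < inar_time i" for i r
    by (intro measurable_compose[OF inar_measurable_avoiding[OF that]]) measurable
  note to_M = measurable_from_subalg[OF sigma_avoiding_subalgebra]
  have Tpow_meas_M: "(\<lambda>w. d (\<alpha> w) ^ T r w) \<in> borel_measurable M" for r
    by (rule to_M[OF Tpow_meas[of "Innovation (Suc k)"]]) auto
  \<comment> \<open>The innovation goes first: the thinned sum \<open>T 0\<close> does not involve
    it and can be part of the test function.\<close>
  have X_Suc: "d (\<alpha> w) ^ X (Suc k) w = d (\<alpha> w) ^ T 0 w * d (\<alpha> w) ^ Y (Innovation (Suc k)) w" for w
    by (simp add: T_def power_add)
  have "(LINT w|M. V w * d (\<alpha> w) ^ X (Suc k) w)
      = (LINT w|M. V w * d (\<alpha> w) ^ T 0 w * d (\<alpha> w) ^ Y (Innovation (Suc k)) w)"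
    unfolding X_Suc by (simp only: mult.assoc)
  also have "\<dots> = (LINT w|M. V w * d (\<alpha> w) ^ T 0 w * exp (of_real lam * (d (\<alpha> w) - 1)))"
  proof (rule integral_poisson_pgf[where r = "\<lambda>_. lam"])
    show "(\<lambda>w. V w * d (\<alpha> w) ^ T 0 w) \<in> borel_measurable (sigma_avoiding (Innovation (Suc k)))"
      by (intro borel_measurable_times V(1) Tpow_meas) auto
    show "norm (V w * d (\<alpha> w) ^ T 0 w) \<le> C" if "w \<in> space M" for w
      by (intro mult_le V(2) pow_le dn that)
  qed (use d lam_pos innovation[of "Suc k"] in auto)
  also have "\<dots> = (LINT w|M. W 0 w)"
    by (simp add: W_def U_def mult_ac)
  finally have start: "(LINT w|M. V w * d (\<alpha> w) ^ X (Suc k) w) = (LINT w|M. W 0 w)" .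

  have W_Suc: "(LINT w|M. W r w) = (LINT w|M. W (Suc r) w)" for r
  proof -
    let ?i = "Thinning (Suc k) (Suc r)"
    \<comment> \<open>On the event \<open>r < X k w\<close> the variable
      \<open>\<xi> (Suc k) (Suc r)\<close> occurs in the sum, and \<open>G\<close> collects all the
      other factors. Off this event both \<open>W r\<close> and \<open>W (Suc r)\<close> equal
      \<open>R\<close>, because the remaining sum is empty and the minimum is already
      \<open>X k w\<close>.\<close>
    define G where "G w = of_bool (r < X k w) * U w * B w ^ min r (X k w) * d (\<alpha> w) ^ T (Suc r) w" for w
    define R where "R w = of_bool (\<not> r < X k w) * U w * B w ^ min r (X k w)" for w
    have Gn: "norm (G w) \<le> C" if "w \<in> space M" for w
      using mult_le[OF mult_le[OF Un[OF that] pow_le[OF Bn[OF that]]] pow_le[OF dn[OF that]]] C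
      by (simp add: G_def)
    have Rn: "norm (R w) \<le> C" if "w \<in> space M" for w
      using mult_le[OF Un[OF that] pow_le[OF Bn[OF that]]] C by (simp add: R_def)
    have G_meas: "G \<in> borel_measurable (sigma_avoiding ?i)"
      unfolding G_def by (intro borel_measurable_times bool_meas U_meas Tpow_meas Bpow_meas) auto
    have "(\<lambda>w. (1 - of_bool (r < X k w)) * U w * B w ^ min r (X k w))
        \<in> borel_measurable (sigma_avoiding ?i)"
      by (intro borel_measurable_times borel_measurable_diff bool_meas U_meas Bpow_meas) auto
    then have R_meas: "R \<in> borel_measurable (sigma_avoiding ?i)"
      unfolding R_def by (simp add: of_bool_not_iff)
    note [measurable] = to_M[OF G_meas] to_M[OF R_meas] to_M[OF B_meas]
    have xi_meas: "\<xi> (Suc k) (Suc r) \<in> measurable M (count_space UNIV)"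
      using Y_measurable[of ?i] by simp
    have T_split: "T r w = \<xi> (Suc k) (Suc r) w + T (Suc r) w" if "r < X k w" for w
      unfolding T_def using that by (subst sum.atLeast_Suc_atMost) auto
    have T_empty: "T r w = 0" if "\<not> r < X k w" for r w
      using that by (simp add: T_def)
    have W_r: "W r w = G w * d (\<alpha> w) ^ \<xi> (Suc k) (Suc r) w + R w" for w
      by (cases "r < X k w") (auto simp: W_def G_def R_def T_split T_empty power_add)
    have W_Suc_r: "W (Suc r) w = G w * B w + R w" for w
      by (cases "r < X k w") (auto simp: W_def G_def R_def T_empty min_def less_Suc_eq_le not_less
          Suc_le_eq)
    have int_R: "integrable M R"
      by (intro integrable_const_bound[where B = C] AE_I2 Rn) auto
    have int1: "integrable M (\<lambda>w. G w * d (\<alpha> w) ^ \<xi> (Suc k) (Suc r) w)"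
      by (intro integrable_const_bound[where B = C] AE_I2 mult_le Gn pow_le dn
          borel_measurable_times measurable_random_power xi_meas) measurable
    have int2: "integrable M (\<lambda>w. G w * B w)"
      by (intro integrable_const_bound[where B = C] AE_I2 mult_le Gn Bn) auto
    have "(LINT w|M. W r w) = (LINT w|M. G w * d (\<alpha> w) ^ \<xi> (Suc k) (Suc r) w) + (LINT w|M. R w)"
      unfolding W_r by (rule Bochner_Integration.integral_add[OF int1 int_R])
    also have "(LINT w|M. G w * d (\<alpha> w) ^ \<xi> (Suc k) (Suc r) w) = (LINT w|M. G w * B w)"
      unfolding B_def by (rule integral_thinning_pgf[OF _ _ d G_meas Gn]) auto
    also have "\<dots> + (LINT w|M. R w) = (LINT w|M. W (Suc r) w)"
      unfolding W_Suc_r by (rule Bochner_Integration.integral_add[OF int2 int_R, symmetric])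
    finally show ?thesis .
  qed
  have const: "(LINT w|M. W r w) = (LINT w|M. V w * d (\<alpha> w) ^ X (Suc k) w)" for r
    by (induction r) (simp_all only: W_Suc[symmetric] start)
  let ?i = "Innovation (Suc k)"
  have "(\<lambda>r. LINT w|M. W r w) \<longlonglongrightarrow> (LINT w|M. U w * B w ^ X k w)"
  proof (rule integral_bounded_convergence)
    show "W r \<in> borel_measurable M" for r
      unfolding W_def
      by (intro borel_measurable_times Tpow_meas_M to_M[OF U_meas[of ?i]] to_M[OF Bpow_meas[of ?i]]) auto
    show "(\<lambda>w. U w * B w ^ X k w) \<in> borel_measurable M"
      by (intro borel_measurable_times to_M[OF U_meas[of ?i]] to_M[OF Bpow_meas[of ?i "\<lambda>x. x"]]) auto
    show "(\<lambda>r. W r w) \<longlonglongrightarrow> U w * B w ^ X k w" for w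
      by (rule tendsto_eventually, rule eventually_mono[OF eventually_ge_at_top[of "X k w"]])
        (auto simp: W_def T_def min_def)
    show "norm (W r w) \<le> C" if "w \<in> space M" for r w
      unfolding W_def by (intro mult_le Un pow_le Bn dn that)
  qed
  from LIMSEQ_unique[OF this[unfolded const] tendsto_const] show ?thesis
    by (simp only: U_def B_def)
qed

text \<open>Both \<open>g\<close> and \<open>d\<close> vary in the induction: a step multiplies
  \<open>g\<close> by the Poisson factor of the innovation and replaces \<open>d\<close> by a convex
  combination of 1 and \<open>c (Suc N) * d\<close>. The factor has norm at most 1 and the
  combination stays in the unit disc, so the bounds are inherited with the same
  \<open>C\<close>.\<close>

lemma integral_inar_generating_functional:
  fixes c :: "nat \<Rightarrow> complex" and g d :: "real \<Rightarrow> complex"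
  assumes c: "\<And>j. norm (c j) \<le> 1"
    and "g \<in> borel_measurable borel" "\<And>a. a \<in> {0<..<1} \<Longrightarrow> norm (g a) \<le> C"
    and "d \<in> borel_measurable borel" "\<And>a. a \<in> {0<..<1} \<Longrightarrow> norm (d a) \<le> 1"
  shows "(LINT w|M. g (\<alpha> w) * (\<Prod>j=1..N. c j ^ X j w) * d (\<alpha> w) ^ X N w)
       = (LINT w|M. g (\<alpha> w) * exp (of_real lam * inar_cumulant c N (\<alpha> w) (d (\<alpha> w))))"
  using assms(2-)
proof (induction N arbitrary: g d)
  case 0
  note [measurable] = 0(1,3)
  have "(LINT w|M. g (\<alpha> w) * d (\<alpha> w) ^ Y Initial w)
      = (LINT w|M. g (\<alpha> w) * exp (of_real (lam / (1 - \<alpha> w)) * (d (\<alpha> w) - 1)))"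
    by (rule integral_poisson_pgf[where r = "\<lambda>a. lam / (1 - a)" and C = C])
      (use 0 lam_pos initial alpha_range in auto)
  then show ?case by simp
next
  case (Suc N)
  note [measurable] = Suc(2,4)
  have C: "0 \<le> C"
    using order_trans[OF norm_ge_zero Suc(3)[of "1/2"]] by simp
  have mult_le: "norm (x * y) \<le> C" if "norm x \<le> C" "norm y \<le> 1" for x y :: complex
    using mult_mono[OF that] C by (simp add: norm_mult)
  let ?d = "\<lambda>a. c (Suc N) * d a"
  let ?V = "\<lambda>w. g (\<alpha> w) * (\<Prod>j=1..N. c j ^ X j w)"
  have dn: "norm (?d a) \<le> 1" if "a \<in> {0<..<1}" for a
    using mult_mono[OF c[of "Suc N"] Suc(5)[OF that]] by (simp add: norm_mult)
  have pn: "norm (\<Prod>j=1..N. c j ^ X j w) \<le> 1" for w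
    unfolding prod_norm[symmetric] by (intro prod_le_1) (simp add: norm_power power_le_one c)
  have "(LINT w|M. g (\<alpha> w) * (\<Prod>j=1..Suc N. c j ^ X j w) * d (\<alpha> w) ^ X (Suc N) w)
      = (LINT w|M. ?V w * ?d (\<alpha> w) ^ X (Suc N) w)"
    by (simp add: power_mult_distrib mult_ac)
  also have "\<dots> = (LINT w|M. ?V w * exp (of_real lam * (?d (\<alpha> w) - 1))
            * (1 - of_real (\<alpha> w) + of_real (\<alpha> w) * ?d (\<alpha> w)) ^ X N w)"
  proof (rule integral_inar_step)
    show "?V \<in> borel_measurable (sigma_avoiding i)" if "N < inar_time i" for i
      using that by (intro borel_measurable_times borel_measurable_prod measurable_random_power
          inar_measurable_avoiding) auto
    show "norm (?V w) \<le> C" if "w \<in> space M" for w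
      using Suc(3) alpha_range that by (intro mult_le pn) auto
  qed (use dn in auto)
  also have "\<dots> = (LINT w|M. (g (\<alpha> w) * exp (of_real lam * (?d (\<alpha> w) - 1)))
            * (\<Prod>j=1..N. c j ^ X j w)
            * (1 - of_real (\<alpha> w) + of_real (\<alpha> w) * ?d (\<alpha> w)) ^ X N w)"
    by (simp only: mult_ac)
  also have "\<dots> = (LINT w|M. (g (\<alpha> w) * exp (of_real lam * (?d (\<alpha> w) - 1)))
            * exp (of_real lam * inar_cumulant c N (\<alpha> w)
                (1 - of_real (\<alpha> w) + of_real (\<alpha> w) * ?d (\<alpha> w))))"
  proof (rule Suc.IH)
    show "norm (g a * exp (of_real lam * (?d a - 1))) \<le> C" if "a \<in> {0<..<1}" for a
      using lam_pos by (intro mult_le Suc(3) that norm_exp_of_real_mult_diff_le_1 dn) auto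
    show "norm (1 - of_real a + of_real a * ?d a) \<le> 1" if "a \<in> {0<..<1}" for a
      using that dn[OF that] by (intro norm_convex_combination_le_1) auto
  qed measurable
  also have "\<dots> = (LINT w|M. g (\<alpha> w) * exp (of_real lam * inar_cumulant c (Suc N) (\<alpha> w) (d (\<alpha> w))))"
    by (simp add: exp_add[symmetric] ring_distribs mult.assoc)
  finally show ?case .
qed

end

section \<open>Closed forms of the exponent\<close>

definition cis_sum :: "(int \<Rightarrow> real) \<Rightarrow> int \<Rightarrow> int \<Rightarrow> complex" where
  "cis_sum u l k = iexp (\<Sum>j=l..k. u j)"

definition cis_sum_remainder :: "(int \<Rightarrow> real) \<Rightarrow> int \<Rightarrow> int \<Rightarrow> complex" where
  "cis_sum_remainder u l k = cis_sum u l k - 1 - \<i> * of_real (\<Sum>j=l..k. u j)"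

text \<open>\<open>1 + weighted_sum u a N\<close> is the coefficient of \<open>d - 1\<close> in \<open>(1 - a) * inar_cumulant c N a d\<close>,
  and \<open>pair_sum u a N\<close> is its value at \<open>d = 1\<close>, for \<open>c k = iexp (u k)\<close>.\<close>

definition weighted_sum :: "(int \<Rightarrow> real) \<Rightarrow> real \<Rightarrow> int \<Rightarrow> complex" where
  "weighted_sum u a N =
     (\<Sum>k=1..N. of_real (a powi (N - k)) * (iexp (u k) - 1) * cis_sum u (k + 1) N)"

definition interaction :: "(int \<Rightarrow> real) \<Rightarrow> real \<Rightarrow> int \<Rightarrow> int \<Rightarrow> complex" where
  "interaction u a k1 k2 =
     of_real (a powi (k2 - k1)) * (iexp (u k1) - 1) * (iexp (u k2) - 1) * cis_sum u (k1 + 1) (k2 - 1)"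

definition pair_sum :: "(int \<Rightarrow> real) \<Rightarrow> real \<Rightarrow> int \<Rightarrow> complex" where
  "pair_sum u a N =
     (\<Sum>k=1..N. iexp (u k) - 1) + (\<Sum>k1=1..N. \<Sum>k2=k1+1..N. interaction u a k1 k2)"

text \<open>This is \<open>Ktilde_closed\<close> with \<open>u\<close> and \<open>N\<close> free, as
  an induction on \<open>N\<close> requires. Its weights are those of the population picture: an
  individual entering at time \<open>l\<close> is last alive at time \<open>k\<close> with
  probability \<open>(1 - a) * a ^ (k - l)\<close> and is still alive at time \<open>N\<close> with
  probability \<open>a ^ (N - l)\<close>. The first two summands collect the entrances at times
  \<open>l <= 0\<close>.\<close>

definition path_sum :: "(int \<Rightarrow> real) \<Rightarrow> real \<Rightarrow> int \<Rightarrow> complex" where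
  "path_sum u a N =
     (\<Sum>k=1..N - 1. of_real (a powi k) * cis_sum_remainder u 1 k)
     + of_real (a powi N / (1 - a)) * cis_sum_remainder u 1 N
     + (\<Sum>l=1..N. of_real (1 - a) * (\<Sum>k=l..N - 1. of_real (a powi (k - l)) * cis_sum_remainder u l k)
         + of_real (a powi (N - l)) * cis_sum_remainder u l N)"

lemma atLeastAtMost_int_Suc: "l \<le> N + 1 \<Longrightarrow> {l..N + 1} = insert (N + 1) {l..N :: int}"
  by auto

lemma sum_int_Suc:
  fixes f :: "int \<Rightarrow> 'a :: comm_monoid_add"
  shows "l \<le> N + 1 \<Longrightarrow> sum f {l..N + 1} = sum f {l..N} + f (N + 1)"
  by (simp add: atLeastAtMost_int_Suc) (rule add.commute)

text \<open>For \<open>a = 0\<close> the exponent law fails when the exponents have opposite signs.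
  With nonnegative exponents it also holds at 0, a point that the claim about \<open>Ktilde\<close>
  includes.\<close>

lemma power_int_add_nonneg:
  fixes a :: "'a :: field"
  assumes "0 \<le> m" "0 \<le> n"
  shows "a powi (m + n) = a powi m * a powi n"
  using assms by (metis power_int_add power_int_0_left_if add_nonneg_eq_0_iff mult_1 power_int_0_right)

lemma power_int_Suc_nonneg:
  fixes a :: "'a :: field"
  shows "0 \<le> n \<Longrightarrow> a powi (n + 1) = a * a powi n"
  using power_int_add_nonneg[of n 1 a] by simp

lemma cis_sum_Suc:
  "l \<le> N + 1 \<Longrightarrow> cis_sum u l (N + 1) = cis_sum u l N * iexp (u (N + 1))"
  by (simp add: cis_sum_def sum_int_Suc exp_add[symmetric] ring_distribs)

lemma cis_sum_empty [simp]: "k < l \<Longrightarrow> cis_sum u l k = 1"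
  by (simp add: cis_sum_def)

lemma weighted_sum_Suc:
  assumes "0 \<le> N"
  shows "weighted_sum u a (N + 1) =
    of_real a * iexp (u (N + 1)) * weighted_sum u a N + (iexp (u (N + 1)) - 1)"
proof -
  have "of_real (a powi (N + 1 - k)) * (iexp (u k) - 1) * cis_sum u (k + 1) (N + 1)
      = of_real a * iexp (u (N + 1)) * (of_real (a powi (N - k)) * (iexp (u k) - 1) * cis_sum u (k + 1) N)"
    if "k \<in> {1..N}" for k
  proof -
    have "cis_sum u (k + 1) (N + 1) = cis_sum u (k + 1) N * iexp (u (N + 1))"
      using that by (intro cis_sum_Suc) simp
    moreover have "a powi (N + 1 - k) = a * a powi (N - k)"
      using that power_int_Suc_nonneg[of "N - k" a] by (simp add: add_diff_eq diff_add_eq)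
    ultimately show ?thesis by simp
  qed
  then have "(\<Sum>k=1..N. of_real (a powi (N + 1 - k)) * (iexp (u k) - 1) * cis_sum u (k + 1) (N + 1))
      = of_real a * iexp (u (N + 1)) * weighted_sum u a N"
    unfolding weighted_sum_def sum_distrib_left by (rule sum.cong[OF refl])
  then show ?thesis
    using assms by (simp add: weighted_sum_def[of u a "N + 1"] sum_int_Suc)
qed

text \<open>The new pairs are those with \<open>k2 = N + 1\<close>. Taking out
  \<open>iexp (u (N + 1)) - 1\<close> and one power of \<open>a\<close> leaves
  \<open>weighted_sum u a N\<close>, because the phase in \<open>interaction\<close> stops at
  \<open>k2 - 1 = N\<close>.\<close>

lemma pair_sum_Suc:
  assumes "0 \<le> N"
  shows "pair_sum u a (N + 1) =
    pair_sum u a N + (iexp (u (N + 1)) - 1) * (1 + of_real a * weighted_sum u a N)"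
proof -
  have "(\<Sum>k1=1..N + 1. \<Sum>k2=k1+1..N + 1. interaction u a k1 k2)
      = (\<Sum>k1=1..N. \<Sum>k2=k1+1..N. interaction u a k1 k2) + (\<Sum>k1=1..N. interaction u a k1 (N + 1))"
    using assms by (simp add: sum_int_Suc sum.distrib)
  also have "(\<Sum>k1=1..N. interaction u a k1 (N + 1))
      = (iexp (u (N + 1)) - 1) * (of_real a * weighted_sum u a N)"
    unfolding weighted_sum_def sum_distrib_left
  proof (intro sum.cong refl)
    fix k assume "k \<in> {1..N}"
    then show "interaction u a k (N + 1) = (iexp (u (N + 1)) - 1) *
        (of_real a * (of_real (a powi (N - k)) * (iexp (u k) - 1) * cis_sum u (k + 1) N))"
      using power_int_Suc_nonneg[of "N - k" a] by (simp add: interaction_def algebra_simps)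
  qed
  finally show ?thesis
    using assms by (simp add: pair_sum_def sum_int_Suc ring_distribs)
qed

text \<open>Put \<open>z = iexp (u (N + 1))\<close>. The argument \<open>d'\<close> handed down
  satisfies \<open>d' - 1 = a * (z * d - 1)\<close>, and
  \<open>z * d - 1 = (z - 1) + z * (d - 1)\<close>. Inserted into the induction hypothesis, the part
  free of \<open>d - 1\<close> is the recursion of \<open>pair_sum\<close>, and the coefficient of
  \<open>d - 1\<close> is that of \<open>1 + weighted_sum\<close>. The factor \<open>1 - a\<close>
  clears the denominator left by the initial law.\<close>

lemma inar_cumulant_eq:
  assumes "a \<noteq> 1"
  shows "of_real (1 - a) * inar_cumulant (\<lambda>j. iexp (u (int j))) N a d
       = pair_sum u a (int N) + (d - 1) * (1 + weighted_sum u a (int N))"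
proof (induction N arbitrary: d)
  case 0
  then show ?case
    using assms by (simp add: pair_sum_def weighted_sum_def)
next
  case (Suc N)
  have N: "int (Suc N) = int N + 1" by simp
  show ?case
    unfolding N pair_sum_Suc[OF of_nat_0_le_iff] weighted_sum_Suc[OF of_nat_0_le_iff]
      inar_cumulant.simps ring_distribs(1) Suc.IH
    by (simp add: algebra_simps)
qed

text \<open>Both sides start at 1 and satisfy \<open>x' = a * z * x + (1 - a) * z\<close> with
  \<open>z = iexp (u (N + 1))\<close>. The right-hand side is the shape in which this quantity
  arises as an increment of \<open>path_sum\<close>.\<close>

lemma weighted_sum_eq:
  assumes "0 \<le> N"
  shows "1 + weighted_sum u a N = of_real (a powi N) * cis_sum u 1 N
    + of_real (1 - a) * (\<Sum>l=1..N. of_real (a powi (N - l)) * cis_sum u l N)"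
  using assms
proof (induction N rule: int_ge_induct)
  case base
  then show ?case by (simp add: weighted_sum_def)
next
  case (step N)
  let ?z = "iexp (u (N + 1))"
  have "(\<Sum>l=1..N. of_real (a powi (N + 1 - l)) * cis_sum u l (N + 1))
      = of_real a * ?z * (\<Sum>l=1..N. of_real (a powi (N - l)) * cis_sum u l N)"
    unfolding sum_distrib_left
  proof (intro sum.cong refl)
    fix l assume "l \<in> {1..N}"
    then have "cis_sum u l (N + 1) = cis_sum u l N * ?z" "a powi (N + 1 - l) = a * a powi (N - l)"
      using power_int_Suc_nonneg[of "N - l" a] by (simp_all add: cis_sum_Suc add_diff_eq diff_add_eq)
    then show "of_real (a powi (N + 1 - l)) * cis_sum u l (N + 1)
        = of_real a * ?z * (of_real (a powi (N - l)) * cis_sum u l N)"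
      by simp
  qed
  then have "of_real (a powi (N + 1)) * cis_sum u 1 (N + 1)
      + of_real (1 - a) * (\<Sum>l=1..N + 1. of_real (a powi (N + 1 - l)) * cis_sum u l (N + 1))
    = of_real a * ?z * (of_real (a powi N) * cis_sum u 1 N
      + of_real (1 - a) * (\<Sum>l=1..N. of_real (a powi (N - l)) * cis_sum u l N)) + of_real (1 - a) * ?z"
  proof -
    assume S: "(\<Sum>l=1..N. of_real (a powi (N + 1 - l)) * cis_sum u l (N + 1))
      = of_real a * ?z * (\<Sum>l=1..N. of_real (a powi (N - l)) * cis_sum u l N)"
    have "of_real (a powi (N + 1)) * cis_sum u 1 (N + 1)
        = of_real a * ?z * (of_real (a powi N) * cis_sum u 1 N)"
      using step(1) by (simp add: cis_sum_Suc power_int_Suc_nonneg)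
    moreover have "(\<Sum>l=1..N + 1. of_real (a powi (N + 1 - l)) * cis_sum u l (N + 1))
        = of_real a * ?z * (\<Sum>l=1..N. of_real (a powi (N - l)) * cis_sum u l N) + ?z"
      using step(1) S by (simp add: sum_int_Suc cis_sum_def[of u "N + 1"])
    ultimately show ?thesis
      by (simp only: ring_distribs mult_ac add_ac)
  qed
  then show ?case
    unfolding step.IH[symmetric] weighted_sum_Suc[OF step(1)] by (simp add: algebra_simps)
qed

lemma cis_sum_remainder_Suc:
  "l \<le> N + 1 \<Longrightarrow> cis_sum_remainder u l (N + 1) = cis_sum_remainder u l N
     + ((iexp (u (N + 1)) - 1) * cis_sum u l N - \<i> * of_real (u (N + 1)))"
  by (simp add: cis_sum_remainder_def cis_sum_Suc sum_int_Suc ring_distribs)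

text \<open>When the endpoint moves from \<open>N\<close> to \<open>N + 1\<close>, the weight of the
  remainder from \<open>l\<close> to \<open>N\<close> becomes
  \<open>(1 - a) * a ^ (N - l) + a * a ^ (N - l)\<close>, which is the old weight. So only the
  increments of the remainders survive, weighted by \<open>a * a ^ (N - l)\<close>. Their sum is
  evaluated by \<open>weighted_sum_eq\<close>, for \<open>u\<close> and for the zero
  function.\<close>

lemma path_sum_Suc:
  assumes "0 \<le> N" "a \<noteq> 1"
  shows "of_real (1 - a) * path_sum u a (N + 1) = of_real (1 - a) * path_sum u a N
    + (iexp (u (N + 1)) - 1) * (1 + of_real a * weighted_sum u a N) - \<i> * of_real (u (N + 1))"
proof -
  let ?f = "cis_sum_remainder u" and ?v = "iexp (u (N + 1)) - 1" and ?w = "\<i> * of_real (u (N + 1))"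
  define q where "q = complex_of_real (1 - a)"
  have q: "q \<noteq> 0" "of_real (a powi n / (1 - a)) = of_real (a powi n) / q" for n
    using assms(2) by (simp_all add: q_def)
  have E: "of_real (a powi N) * cis_sum u 1 N + q * (\<Sum>l=1..N. of_real (a powi (N - l)) * cis_sum u l N)
      = 1 + weighted_sum u a N"
    unfolding q_def by (rule weighted_sum_eq[OF assms(1), symmetric])
  \<comment> \<open>For \<open>u = 0\<close> the previous identity is the geometric sum.\<close>
  have G: "of_real (a powi N) + q * (\<Sum>l=1..N. of_real (a powi (N - l))) = 1"
    unfolding q_def using weighted_sum_eq[OF assms(1), of "\<lambda>_. 0" a]
    by (simp add: weighted_sum_def cis_sum_def)
  \<comment> \<open>For \<open>N = 0\<close> both index ranges are empty, and the extra term
    vanishes because the remainder of an empty sum is 0.\<close>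
  have head: "(\<Sum>k=1..N. of_real (a powi k) * ?f 1 k)
      = (\<Sum>k=1..N - 1. of_real (a powi k) * ?f 1 k) + of_real (a powi N) * ?f 1 N"
  proof (cases "N = 0")
    case False
    then show ?thesis
      using sum_int_Suc[of 1 "N - 1" "\<lambda>k. of_real (a powi k) * ?f 1 k"] assms(1) by simp
  qed (simp add: cis_sum_remainder_def)
  have inner: "q * (\<Sum>k=l..N. of_real (a powi (k - l)) * ?f l k) + of_real (a powi (N + 1 - l)) * ?f l (N + 1)
      = q * (\<Sum>k=l..N - 1. of_real (a powi (k - l)) * ?f l k) + of_real (a powi (N - l)) * ?f l N
        + of_real a * (?v * (of_real (a powi (N - l)) * cis_sum u l N) - ?w * of_real (a powi (N - l)))"
    if l: "l \<in> {1..N}" for l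
  proof -
    have "(\<Sum>k=l..N. of_real (a powi (k - l)) * ?f l k)
        = (\<Sum>k=l..N - 1. of_real (a powi (k - l)) * ?f l k) + of_real (a powi (N - l)) * ?f l N"
      using sum_int_Suc[of l "N - 1" "\<lambda>k. of_real (a powi (k - l)) * ?f l k"] l by simp
    moreover have "a powi (N + 1 - l) = a * a powi (N - l)"
      using power_int_Suc_nonneg[of "N - l" a] l by (simp add: add_diff_eq diff_add_eq)
    moreover have "?f l (N + 1) = ?f l N + (?v * cis_sum u l N - ?w)"
      using l by (intro cis_sum_remainder_Suc) simp
    moreover have "of_real a = 1 - q" by (simp add: q_def)
    ultimately show ?thesis
      by (simp only: of_real_mult) (simp only: algebra_simps mult_1)
  qed
  define I where "I K l = q * (\<Sum>k=l..K - 1. of_real (a powi (k - l)) * ?f l k)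
      + of_real (a powi (K - l)) * ?f l K" for K l
  define SE where "SE = (\<Sum>l=1..N. of_real (a powi (N - l)) * cis_sum u l N)"
  define SP where "SP = (\<Sum>l=1..N. complex_of_real (a powi (N - l)))"
  define P where "P = (\<Sum>k=1..N - 1. of_real (a powi k) * ?f 1 k)"
  define aN where "aN = complex_of_real (a powi N)"
  have path: "path_sum u a K = (\<Sum>k=1..K - 1. of_real (a powi k) * ?f 1 k)
      + of_real (a powi K) / q * ?f 1 K + (\<Sum>l=1..K. I K l)" for K
    by (simp only: path_sum_def q(2) I_def q_def)
  have "(\<Sum>l=1..N. I (N + 1) l)
      = (\<Sum>l=1..N. I N l + of_real a * (?v * (of_real (a powi (N - l)) * cis_sum u l N)
          - ?w * of_real (a powi (N - l))))"
    using inner by (intro sum.cong refl) (simp only: I_def add_diff_cancel_right')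
  also have "\<dots> = (\<Sum>l=1..N. I N l) + of_real a * (?v * SE - ?w * SP)"
    by (simp only: SE_def SP_def sum.distrib sum_subtractf sum_distrib_left right_diff_distrib)
  finally have "(\<Sum>l=1..N + 1. I (N + 1) l)
      = (\<Sum>l=1..N. I N l) + of_real a * (?v * SE - ?w * SP) + I (N + 1) (N + 1)"
    using assms(1) by (simp only: sum_int_Suc)
  moreover have "I (N + 1) (N + 1) = ?v - ?w"
    by (simp add: I_def cis_sum_remainder_def cis_sum_def)
  moreover have "?f 1 (N + 1) = ?f 1 N + (?v * cis_sum u 1 N - ?w)"
    using assms(1) by (intro cis_sum_remainder_Suc) simp
  moreover have "of_real (a powi (N + 1)) = of_real a * aN"
    using assms(1) by (simp add: power_int_Suc_nonneg aN_def)
  ultimately have Suc: "path_sum u a (N + 1) = (P + aN * ?f 1 N)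
      + of_real a * aN / q * (?f 1 N + (?v * cis_sum u 1 N - ?w))
      + ((\<Sum>l=1..N. I N l) + of_real a * (?v * SE - ?w * SP) + (?v - ?w))"
    by (simp only: path[of "N + 1"] add_diff_cancel_right' head P_def aN_def)
  have a: "of_real a = 1 - q"
    by (simp add: q_def)
  have "q * path_sum u a (N + 1) = q * path_sum u a N
      + of_real a * (?v * (aN * cis_sum u 1 N + q * SE) - ?w * (aN + q * SP)) + q * (?v - ?w)"
    unfolding Suc path[of N] P_def[symmetric] aN_def[symmetric] a
    using q(1) by (simp add: field_simps)
  also have "\<dots> = q * path_sum u a N + ?v * (1 + of_real a * weighted_sum u a N) - ?w"
    using E G unfolding SE_def[symmetric] SP_def[symmetric] aN_def[symmetric]
    by (simp only:) (simp add: q_def algebra_simps)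
  finally show ?thesis
    by (simp only: q_def)
qed

text \<open>The increments in \<open>N\<close> agree by \<open>path_sum_Suc\<close> and
  \<open>pair_sum_Suc\<close>. For \<open>u\<close> the function
  \<open>theta_tilde n m t \<theta>\<close> and \<open>N = fl n t m\<close>, this is the relation
  between the two exponents of the theorem: \<open>1 - a\<close> times the closed form of
  \<open>Ktilde\<close> is \<open>K_fun\<close>.\<close>

lemma path_sum_eq_pair_sum:
  assumes "0 \<le> N" "a \<noteq> 1"
  shows "of_real (1 - a) * path_sum u a N = pair_sum u a N - \<i> * of_real (\<Sum>k=1..N. u k)"
  using assms(1)
proof (induction N rule: int_ge_induct)
  case base
  then show ?case
    by (simp add: path_sum_def pair_sum_def cis_sum_remainder_def)
next
  case (step N)
  then show ?case
    unfolding path_sum_Suc[OF step(1) assms(2)] step.IH pair_sum_Suc[OF step(1)]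
    by (simp add: sum_int_Suc ring_distribs)
qed

section \<open>Regrouping times into the blocks between consecutive sampling times\<close>

lemma sum_int_split:
  fixes f :: "int \<Rightarrow> 'a :: comm_monoid_add"
  assumes "a \<le> b" "b \<le> c"
  shows "(\<Sum>k=a+1..c. f k) = (\<Sum>k=a+1..b. f k) + (\<Sum>k=b+1..c. f k)"
proof -
  have "{a+1..c} = {a+1..b} \<union> {b+1..c}" using assms by auto
  then show ?thesis by (simp add: sum.union_disjoint)
qed

text \<open>Weak monotonicity is the right hypothesis: the integer parts of distinct times may
  coincide, and the block between them is then empty.\<close>

lemma sum_blocks:
  fixes f :: "int \<Rightarrow> 'a :: comm_monoid_add" and N :: "nat \<Rightarrow> int"
  assumes "p \<le> q" "mono_on {p..q} N"
  shows "(\<Sum>k=N p+1..N q. f k) = (\<Sum>l=p+1..q. \<Sum>k=N (l - 1)+1..N l. f k)"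
  using assms
proof (induction q rule: dec_induct)
  case (step q)
  have "N p \<le> N q" "N q \<le> N (Suc q)"
    using step by (auto intro!: mono_onD[OF step(4)])
  moreover have "mono_on {p..q} N"
    using step(4) by (rule mono_on_subset) auto
  ultimately show ?case
    using step by (simp add: sum_int_split[of "N p" "N q" "N (Suc q)"])
qed simp

text \<open>For a pair \<open>k1 < k2\<close>, either \<open>k2\<close> lies in the block of
  \<open>k1\<close> or in a later one. These two cases give the third and the second sum of
  \<open>K_fun\<close>.\<close>

lemma sum_pairs_blocks:
  fixes h :: "int \<Rightarrow> int \<Rightarrow> complex" and N :: "nat \<Rightarrow> int"
  assumes mono: "mono_on {0..m} N" and N0: "N 0 = 0"
  shows "(\<Sum>k1=1..N m. \<Sum>k2=k1+1..N m. h k1 k2)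
     = (\<Sum>l1=1..m. \<Sum>l2=l1+1..m. \<Sum>k1=N (l1 - 1)+1..N l1. \<Sum>k2=N (l2 - 1)+1..N l2. h k1 k2)
     + (\<Sum>l=1..m. \<Sum>k1=N (l - 1)+1..N l. \<Sum>k2=k1+1..N l. h k1 k2)"
proof -
  have "(\<Sum>k1=1..N m. \<Sum>k2=k1+1..N m. h k1 k2)
      = (\<Sum>l=1..m. \<Sum>k1=N (l - 1)+1..N l. \<Sum>k2=k1+1..N m. h k1 k2)"
    using sum_blocks[of 0 m N "\<lambda>k1. \<Sum>k2=k1+1..N m. h k1 k2"] mono N0 by simp
  also have "\<dots> = (\<Sum>l1=1..m. (\<Sum>l2=l1+1..m. \<Sum>k1=N (l1 - 1)+1..N l1. \<Sum>k2=N (l2 - 1)+1..N l2. h k1 k2)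
      + (\<Sum>k1=N (l1 - 1)+1..N l1. \<Sum>k2=k1+1..N l1. h k1 k2))"
  proof (rule sum.cong[OF refl])
    fix l assume l: "l \<in> {1..m}"
    have "N l \<le> N m" using l by (auto intro!: mono_onD[OF mono])
    moreover have "mono_on {l..m} N" using mono by (rule mono_on_subset) auto
    ultimately have "(\<Sum>k2=k1+1..N m. h k1 k2)
        = (\<Sum>k2=k1+1..N l. h k1 k2) + (\<Sum>l2=l+1..m. \<Sum>k2=N (l2 - 1)+1..N l2. h k1 k2)"
      if "k1 \<in> {N (l - 1)+1..N l}" for k1
      using that l sum_int_split[of k1 "N l" "N m" "h k1"] sum_blocks[of l m N "h k1"] by simp
    then have "(\<Sum>k1=N (l - 1)+1..N l. \<Sum>k2=k1+1..N m. h k1 k2)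
       = (\<Sum>k1=N (l - 1)+1..N l. (\<Sum>k2=k1+1..N l. h k1 k2)
            + (\<Sum>l2=l+1..m. \<Sum>k2=N (l2 - 1)+1..N l2. h k1 k2))"
      by (rule sum.cong[OF refl])
    also have "\<dots> = (\<Sum>l2=l+1..m. \<Sum>k1=N (l - 1)+1..N l. \<Sum>k2=N (l2 - 1)+1..N l2. h k1 k2)
      + (\<Sum>k1=N (l - 1)+1..N l. \<Sum>k2=k1+1..N l. h k1 k2)"
      unfolding sum.distrib by (subst sum.swap) (rule add.commute)
    finally show "(\<Sum>k1=N (l - 1)+1..N l. \<Sum>k2=k1+1..N m. h k1 k2) = \<dots>" .
  qed
  finally show ?thesis
    by (simp only: sum.distrib)
qed

context
  fixes n m :: nat and t \<theta> :: "nat \<Rightarrow> real"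
  assumes t0: "t 0 = 0" and t_less: "\<And>l. l < m \<Longrightarrow> t l < t (Suc l)"
begin

lemma t_mono: "mono_on {0..m} t"
proof (rule mono_onI)
  fix p q assume "p \<in> {0..m}" "q \<in> {0..m}" "p \<le> q"
  show "t p \<le> t q"
    using \<open>p \<le> q\<close> \<open>q \<in> {0..m}\<close>
  proof (induction q rule: dec_induct)
    case (step q)
    then show ?case using t_less[of q] by simp
  qed simp
qed

lemma fl_0: "fl n t 0 = 0"
  by (simp add: fl_def t0)

lemma fl_mono: "mono_on {0..m} (fl n t)"
  unfolding fl_def
  by (intro mono_onI floor_mono mult_left_mono mono_onD[OF t_mono]) auto

lemma fl_nonneg: "l \<le> m \<Longrightarrow> 0 \<le> fl n t l"
  using mono_onD[OF fl_mono, of 0 l] fl_0 by simp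

text \<open>For \<open>k\<close> in block \<open>l\<close> the indicator of
  \<open>k \<le> fl n t i\<close> is 1 exactly when \<open>l \<le> i\<close>, by monotonicity of the
  integer parts, so a tail of the coefficients remains.\<close>

lemma theta_tilde_block:
  assumes l: "l \<in> {1..m}" and k: "k \<in> {fl n t (l - 1)+1..fl n t l}"
  shows "theta_tilde n m t \<theta> k = tail_sum \<theta> m l"
proof -
  have "k \<le> fl n t i \<longleftrightarrow> l \<le> i" if "i \<in> {1..m}" for i
  proof (cases "l \<le> i")
    case True
    with mono_onD[OF fl_mono, of l i] l k that show ?thesis by auto
  next
    case False
    then have "i \<le> l - 1" "l - 1 \<le> m" using l by auto
    with mono_onD[OF fl_mono, of i "l - 1"] l k that False show ?thesis by auto
  qed
  then have "theta_tilde n m t \<theta> k = (\<Sum>i=1..m. if l \<le> i then \<theta> i else 0)"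
    unfolding theta_tilde_def by (intro sum.cong) auto
  also have "\<dots> = (\<Sum>i\<in>{1..m} \<inter> {i. l \<le> i}. \<theta> i)"
    by (simp add: sum.inter_restrict)
  also have "{1..m} \<inter> {i. l \<le> i} = {l..m}"
    using l by auto
  finally show ?thesis
    by (simp add: tail_sum_def)
qed

lemma sum_theta_tilde_within_block:
  assumes l: "l \<in> {1..m}" and "fl n t (l - 1) \<le> x" "x \<le> y" "y \<le> fl n t l"
  shows "(\<Sum>k=x+1..y. theta_tilde n m t \<theta> k) = of_int (y - x) * tail_sum \<theta> m l"
proof -
  have "(\<Sum>k=x+1..y. theta_tilde n m t \<theta> k) = (\<Sum>k=x+1..y. tail_sum \<theta> m l)"
    using assms by (intro sum.cong refl theta_tilde_block) auto
  then show ?thesis using assms by simp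
qed

lemma K_fun_eq:
  "K_fun n m t \<theta> a = pair_sum (theta_tilde n m t \<theta>) a (fl n t m)
     - \<i> * of_real (\<Sum>k=1..fl n t m. theta_tilde n m t \<theta> k)"
proof -
  let ?u = "theta_tilde n m t \<theta>" and ?N = "fl n t" and ?T = "tail_sum \<theta> m"
  have le: "?N (l - 1) \<le> ?N l" if "l \<in> {1..m}" for l
    using that by (intro mono_onD[OF fl_mono]) auto
  have "(\<Sum>k=1..?N m. iexp (?u k) - 1 - \<i> * of_real (?u k))
      = (\<Sum>l=1..m. \<Sum>k=?N (l - 1)+1..?N l. iexp (?u k) - 1 - \<i> * of_real (?u k))"
    using sum_blocks[OF _ fl_mono, of "\<lambda>k. iexp (?u k) - 1 - \<i> * of_real (?u k)"] fl_0 by simp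
  also have "\<dots> = (\<Sum>l=1..m. (iexp (?T l) - 1 - \<i> * of_real (?T l)) * of_int (?N l - ?N (l - 1)))"
  proof (rule sum.cong[OF refl])
    fix l assume l: "l \<in> {1..m}"
    have "(\<Sum>k=?N (l - 1)+1..?N l. iexp (?u k) - 1 - \<i> * of_real (?u k))
        = (\<Sum>k=?N (l - 1)+1..?N l. iexp (?T l) - 1 - \<i> * of_real (?T l))"
      using theta_tilde_block[OF l] by (intro sum.cong refl) simp
    then show "(\<Sum>k=?N (l - 1)+1..?N l. iexp (?u k) - 1 - \<i> * of_real (?u k))
        = (iexp (?T l) - 1 - \<i> * of_real (?T l)) * of_int (?N l - ?N (l - 1))"
      using le[OF l] by (simp add: mult.commute)
  qed
  finally have 1: "(\<Sum>k=1..?N m. iexp (?u k) - 1 - \<i> * of_real (?u k)) = \<dots>" .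
  \<comment> \<open>The phase runs over the times strictly between \<open>k1\<close> and
    \<open>k2\<close>: the rest of block \<open>l1\<close>, the full blocks in between, and the
    beginning of block \<open>l2\<close> up to \<open>k2 - 1\<close>.\<close>
  have 2: "interaction ?u a k1 k2 =
      of_real (a powi (k2 - k1)) * (iexp (?T l1) - 1) * (iexp (?T l2) - 1)
         * iexp (of_int (?N l1 - k1) * ?T l1
                 + (\<Sum>l=l1+1..l2-1. ?T l * of_int (?N l - ?N (l - 1)))
                 + of_int (k2 - 1 - ?N (l2 - 1)) * ?T l2)"
    if l1: "l1 \<in> {1..m}" and l2: "l2 \<in> {l1+1..m}" and k1: "k1 \<in> {?N (l1 - 1)+1..?N l1}"
      and k2: "k2 \<in> {?N (l2 - 1)+1..?N l2}" for l1 l2 k1 k2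
  proof -
    have l2': "l2 \<in> {1..m}" using l2 by auto
    have N12: "?N l1 \<le> ?N (l2 - 1)" using l1 l2 by (intro mono_onD[OF fl_mono]) auto
    have "(\<Sum>k=?N l1+1..?N (l2 - 1). ?u k) = (\<Sum>l=l1+1..l2-1. \<Sum>k=?N (l - 1)+1..?N l. ?u k)"
      using l1 l2 by (intro sum_blocks mono_on_subset[OF fl_mono]) auto
    also have "\<dots> = (\<Sum>l=l1+1..l2-1. ?T l * of_int (?N l - ?N (l - 1)))"
    proof (rule sum.cong[OF refl])
      fix l assume "l \<in> {l1+1..l2-1}"
      then have l: "l \<in> {1..m}" using l2 by auto
      show "(\<Sum>k=?N (l - 1)+1..?N l. ?u k) = ?T l * of_int (?N l - ?N (l - 1))"
        using sum_theta_tilde_within_block[OF l order_refl le[OF l] order_refl] by (simp only: mult.commute)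
    qed
    finally have mid: "(\<Sum>k=?N l1+1..?N (l2 - 1). ?u k) = \<dots>" .
    have "(\<Sum>k=k1+1..k2-1. ?u k) = (\<Sum>k=k1+1..?N l1. ?u k) + (\<Sum>k=?N l1+1..?N (l2 - 1). ?u k)
        + (\<Sum>k=?N (l2 - 1)+1..k2-1. ?u k)"
      using k1 k2 N12 sum_int_split[of k1 "?N (l2 - 1)" "k2 - 1" ?u] sum_int_split[of k1 "?N l1" "?N (l2 - 1)" ?u]
      by simp
    also have "(\<Sum>k=k1+1..?N l1. ?u k) = of_int (?N l1 - k1) * ?T l1"
      using k1 by (intro sum_theta_tilde_within_block l1) auto
    also have "(\<Sum>k=?N (l2 - 1)+1..k2-1. ?u k) = of_int (k2 - 1 - ?N (l2 - 1)) * ?T l2"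
      using k2 by (intro sum_theta_tilde_within_block l2') auto
    finally show ?thesis
      unfolding interaction_def cis_sum_def mid theta_tilde_block[OF l1 k1] theta_tilde_block[OF l2' k2]
      by (simp only:)
  qed
  have 3: "interaction ?u a k1 k2 = of_real (a powi (k2 - k1)) * (iexp (?T l) - 1)\<^sup>2
         * iexp (of_int (k2 - k1 - 1) * ?T l)"
    if l: "l \<in> {1..m}" and k1: "k1 \<in> {?N (l - 1)+1..?N l}" and k2: "k2 \<in> {k1+1..?N l}" for l k1 k2
  proof -
    have k2': "k2 \<in> {?N (l - 1)+1..?N l}" using k1 k2 by auto
    have "(\<Sum>k=k1+1..k2-1. ?u k) = of_int (k2 - 1 - k1) * ?T l"
      using k1 k2 by (intro sum_theta_tilde_within_block l) auto
    moreover have "k2 - 1 - k1 = k2 - k1 - 1" by simp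
    ultimately show ?thesis
      unfolding interaction_def cis_sum_def theta_tilde_block[OF l k1] theta_tilde_block[OF l k2']
      by (simp only: power2_eq_square mult.assoc)
  qed
  have "pair_sum ?u a (?N m) - \<i> * of_real (\<Sum>k=1..?N m. ?u k)
      = (\<Sum>k=1..?N m. iexp (?u k) - 1 - \<i> * of_real (?u k))
        + (\<Sum>k1=1..?N m. \<Sum>k2=k1+1..?N m. interaction ?u a k1 k2)"
    by (simp add: pair_sum_def sum_subtractf sum_distrib_left)
  then show ?thesis
    unfolding 1 sum_pairs_blocks[OF fl_mono fl_0] K_fun_def Let_def
    using 2 3 by (simp only: add.assoc cong: sum.cong)
qed

end

section \<open>The infinite series defining \<open>Ktilde\<close> and its closed form\<close>

lemma Ktilde_closed_eq_path_sum:
  "Ktilde_closed n m t \<theta> a = path_sum (theta_tilde n m t \<theta>) a (fl n t m)"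
  by (simp only: Ktilde_closed_def path_sum_def Let_def theta_tilde2_def cis_sum_remainder_def cis_sum_def)

text \<open>For \<open>l \<le> 0\<close> all partial sums start at 1, so \<open>l\<close> enters
  only through the factor \<open>a ^ (- l)\<close> and this part of the series is geometric. Its
  factor \<open>1 / (1 - a)\<close> cancels the \<open>1 - a\<close> before the inner sum and
  produces the denominator in the second summand of the closed form.\<close>

lemma Ktilde_term_has_sum:
  assumes a: "0 \<le> a" "a < 1" and N: "0 \<le> fl n t m"
  shows "(Ktilde_term n m t \<theta> a has_sum Ktilde_closed n m t \<theta> a) {..fl n t m}"
proof -
  let ?N = "fl n t m" and ?f = "cis_sum_remainder (theta_tilde n m t \<theta>)"
  have tm: "Ktilde_term n m t \<theta> a l = of_real (1 - a) * (\<Sum>k=max l 1..?N - 1. of_real (a powi (k - l)) * ?f (max l 1) k)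
      + of_real (a powi (?N - l)) * ?f (max l 1) ?N" for l
    by (simp only: Ktilde_term_def Let_def theta_tilde2_def cis_sum_remainder_def cis_sum_def)
  define c where "c = of_real (1 - a) * (\<Sum>k=1..?N - 1. of_real (a powi k) * ?f 1 k)
      + of_real (a powi ?N) * ?f 1 ?N"
  have neg: "Ktilde_term n m t \<theta> a (- int q) = of_real a ^ q * c" for q
  proof -
    have p: "a powi (k - - int q) = a ^ q * a powi k" if "0 \<le> k" for k
      using power_int_add_nonneg[OF that of_nat_0_le_iff, of a q] by (simp add: mult.commute)
    have m: "max (- int q) 1 = 1" by simp
    have "(\<Sum>k=1..?N - 1. of_real (a powi (k - - int q)) * ?f 1 k)
        = of_real a ^ q * (\<Sum>k=1..?N - 1. of_real (a powi k) * ?f 1 k)"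
      unfolding sum_distrib_left
    proof (intro sum.cong refl)
      fix k assume "k \<in> {1..?N - 1}"
      then have "0 \<le> k" by simp
      then show "of_real (a powi (k - - int q)) * ?f 1 k = of_real a ^ q * (of_real (a powi k) * ?f 1 k)"
        by (simp only: p of_real_mult of_real_power mult.assoc)
    qed
    then show ?thesis
      unfolding tm m p[OF N] c_def by (simp only: of_real_mult of_real_power ring_distribs mult_ac)
  qed
  have "((\<lambda>q. of_real a ^ q * c) has_sum (1 / (1 - of_real a) * c)) UNIV"
  proof (rule norm_summable_imp_has_sum)
    show "summable (\<lambda>q. norm (of_real a ^ q * c))"
      using a by (simp add: norm_mult norm_power summable_mult2 summable_geometric)
    show "(\<lambda>q. of_real a ^ q * c) sums (1 / (1 - of_real a) * c)"
      using a by (intro sums_mult2 geometric_sums) simp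
  qed
  then have "((\<lambda>q. Ktilde_term n m t \<theta> a (- int q)) has_sum (1 / (1 - of_real a) * c)) UNIV"
    by (simp only: neg)
  moreover have "bij_betw (\<lambda>q. - int q) UNIV {..0}"
    by (rule bij_betwI[where g = "\<lambda>l. nat (- l)"]) auto
  ultimately have 1: "(Ktilde_term n m t \<theta> a has_sum (1 / (1 - of_real a) * c)) {..0}"
    by (subst (asm) has_sum_reindex_bij_betw)
  have 2: "(Ktilde_term n m t \<theta> a has_sum (\<Sum>l=1..?N. Ktilde_term n m t \<theta> a l)) {1..?N}"
    by (rule has_sum_finite) simp
  have "(Ktilde_term n m t \<theta> a has_sum (1 / (1 - of_real a) * c + (\<Sum>l=1..?N. Ktilde_term n m t \<theta> a l)))
      ({..0} \<union> {1..?N})"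
    by (rule has_sum_Un_disjoint[OF 1 2]) auto
  moreover have "{..0} \<union> {1..?N} = {..?N}" using N by auto
  moreover have "1 / (1 - of_real a) * c + (\<Sum>l=1..?N. Ktilde_term n m t \<theta> a l) = Ktilde_closed n m t \<theta> a"
  proof -
    have "1 / (1 - of_real a) * c = (\<Sum>k=1..?N - 1. of_real (a powi k) * ?f 1 k)
        + of_real (a powi ?N / (1 - a)) * ?f 1 ?N"
    proof -
      define q where "q = complex_of_real (1 - a)"
      have "q \<noteq> 0" "1 - of_real a = q" "of_real (a powi ?N / (1 - a)) = of_real (a powi ?N) / q"
        using a by (simp_all add: q_def)
      then show ?thesis
        unfolding c_def q_def[symmetric] by (simp only: add_divide_distrib ring_distribs) simp
    qed
    moreover have "(\<Sum>l=1..?N. Ktilde_term n m t \<theta> a l)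
      = (\<Sum>l=1..?N. of_real (1 - a) * (\<Sum>k=l..?N - 1. of_real (a powi (k - l)) * ?f l k)
         + of_real (a powi (?N - l)) * ?f l ?N)"
      by (intro sum.cong refl) (simp only: tm max_absorb1 atLeastAtMost_iff)
    ultimately show ?thesis
      by (simp only: Ktilde_closed_eq_path_sum path_sum_def)
  qed
  ultimately show ?thesis by simp
qed

section \<open>Bounds on the exponent and integration over the mixing density\<close>

text \<open>Each step contributes a number \<open>z - 1\<close> with \<open>z\<close> in the closed
  unit disc and hands down another point of that disc. This keeps the exponential bounded although
  \<open>1 / (1 - a)\<close> is not.\<close>

lemma Re_inar_cumulant_nonpos:
  assumes "\<And>j. norm (c j) \<le> 1" "a \<in> {0<..<1}" "norm d \<le> 1"
  shows "Re (inar_cumulant c N a d) \<le> 0"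
  using assms(3)
proof (induction N arbitrary: d)
  case 0
  have "inar_cumulant c 0 a d = of_real (1 / (1 - a)) * (d - 1)"
    by simp
  moreover have "Re d - 1 \<le> 0"
    using complex_Re_le_cmod[of d] 0 by linarith
  ultimately show ?case
    using assms(2) scaleR_complex.sel(1)[of "1 / (1 - a)" "d - 1"]
    by (simp only: scaleR_conv_of_real) (simp add: divide_nonpos_pos)
next
  case (Suc N)
  have d: "norm (c (Suc N) * d) \<le> 1"
    using mult_mono[OF assms(1)[of "Suc N"] Suc(2)] by (simp add: norm_mult)
  have "Re (c (Suc N) * d) \<le> 1"
    using complex_Re_le_cmod d order_trans by blast
  moreover have "Re (inar_cumulant c N a (1 - of_real a + of_real a * (c (Suc N) * d))) \<le> 0"
    using assms(2) by (intro Suc.IH norm_convex_combination_le_1 d) auto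
  ultimately show ?case by simp
qed

lemma borel_measurable_pair_sum [measurable]:
  "(\<lambda>a. pair_sum u a N) \<in> borel_measurable borel"
proof -
  have [measurable]: "(\<lambda>a::real. a powi k) \<in> borel_measurable borel" for k
    by (cases "0 \<le> k") (simp_all add: power_int_def)
  show ?thesis
    unfolding pair_sum_def interaction_def by measurable
qed

context randomized_poisson_inar1
begin

lemma integral_alpha:
  fixes F :: "real \<Rightarrow> complex"
  assumes F [measurable]: "F \<in> borel_measurable borel"
    and bound: "\<And>a. a \<in> {0<..<1} \<Longrightarrow> norm (F a) \<le> C"
  shows "set_integrable lborel {0<..<1} (\<lambda>a. F a * of_real (\<psi> a * (1 - a) powr \<beta>))"
    and "(LINT w|M. F (\<alpha> w)) = (LINT a:{0<..<1}|lborel. F a * of_real (\<psi> a * (1 - a) powr \<beta>))"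
proof -
  define h where "h x = \<psi> x * (1 - x) powr \<beta> * indicator {0<..<1} x" for x
  have dist: "distributed M lborel \<alpha> (\<lambda>x. ennreal (h x))"
    using alpha_density by (simp add: h_def)
  have h_nonneg: "0 \<le> h x" for x
    using psi_nonneg[of x] by (auto simp: h_def split: split_indicator)
  have h [measurable]: "h \<in> borel_measurable lborel"
    using distributed_real_measurable[OF _ dist] h_nonneg by simp
  have Fh: "h x *\<^sub>R F x = indicator {0<..<1} x *\<^sub>R (F x * of_real (\<psi> x * (1 - x) powr \<beta>))" for x
    by (simp add: h_def scaleR_conv_of_real split: split_indicator)
  have \<alpha>: "\<alpha> \<in> measurable M lborel" by simp
  have F': "F \<in> borel_measurable lborel" by simp
  have dd: "distr M lborel \<alpha> = density lborel (\<lambda>x. ennreal (h x))"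
    by (rule distributed_distr_eq_density[OF dist])
  have "integrable M (\<lambda>w. F (\<alpha> w))"
    by (intro integrable_const_bound[where B = C] AE_I2 bound alpha_range) auto
  then have "integrable (density lborel (\<lambda>x. ennreal (h x))) F"
    unfolding dd[symmetric] by (subst integrable_distr_eq[OF \<alpha> F'])
  then have "integrable lborel (\<lambda>x. h x *\<^sub>R F x)"
    by (subst (asm) integrable_density) (auto simp: h_nonneg)
  then show "set_integrable lborel {0<..<1} (\<lambda>a. F a * of_real (\<psi> a * (1 - a) powr \<beta>))"
    by (simp only: Fh set_integrable_def)
  have "(LINT w|M. F (\<alpha> w)) = integral\<^sup>L (density lborel (\<lambda>x. ennreal (h x))) F"
    unfolding dd[symmetric] by (rule integral_distr[OF \<alpha> F', symmetric])
  also have "\<dots> = (LINT x|lborel. h x *\<^sub>R F x)"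
    by (subst integral_density) (auto simp: h_nonneg)
  finally show "(LINT w|M. F (\<alpha> w)) = (LINT a:{0<..<1}|lborel. F a * of_real (\<psi> a * (1 - a) powr \<beta>))"
    by (simp only: Fh set_lebesgue_integral_def)
qed

lemma sum_S1_eq:
  assumes t0: "t 0 = 0" and t_less: "\<And>l. l < m \<Longrightarrow> t l < t (Suc l)"
  shows "(\<Sum>l=1..m. \<theta> l * S1 lam \<alpha> X0 \<xi> \<epsilon> n (t l) w)
       = (\<Sum>k=1..nat (fl n t m). theta_tilde n m t \<theta> (int k) * (real (X k w) - lam / (1 - \<alpha> w)))"
proof -
  let ?x = "\<lambda>k. real (X k w) - lam / (1 - \<alpha> w)" and ?N = "nat (fl n t m)"
  have "S1 lam \<alpha> X0 \<xi> \<epsilon> n (t l) w = (\<Sum>k=1..?N. of_bool (int k \<le> fl n t l) * ?x k)"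
    if "l \<in> {1..m}" for l
  proof -
    have "fl n t l \<le> fl n t m"
      using that by (intro mono_onD[OF fl_mono[OF t0 t_less]]) auto
    then have "{1..nat (fl n t l)} = {k \<in> {1..?N}. int k \<le> fl n t l}" by auto
    moreover have "S1 lam \<alpha> X0 \<xi> \<epsilon> n (t l) w = (\<Sum>k=1..nat (fl n t l). ?x k)"
      by (simp add: S1_def fl_def)
    ultimately have "S1 lam \<alpha> X0 \<xi> \<epsilon> n (t l) w = (\<Sum>k=1..?N. if int k \<le> fl n t l then ?x k else 0)"
      by (simp only: sum.inter_filter finite_atLeastAtMost)
    also have "\<dots> = (\<Sum>k=1..?N. of_bool (int k \<le> fl n t l) * ?x k)"
      by (intro sum.cong) auto
    finally show ?thesis .
  qed
  then have "(\<Sum>l=1..m. \<theta> l * S1 lam \<alpha> X0 \<xi> \<epsilon> n (t l) w)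
      = (\<Sum>l=1..m. \<Sum>k=1..?N. \<theta> l * of_bool (int k \<le> fl n t l) * ?x k)"
    by (simp only: sum_distrib_left mult.assoc cong: sum.cong)
  also have "\<dots> = (\<Sum>k=1..?N. \<Sum>l=1..m. \<theta> l * of_bool (int k \<le> fl n t l) * ?x k)"
    by (rule sum.swap)
  finally show ?thesis
    by (simp only: theta_tilde_def sum_distrib_right)
qed

text \<open>The centring depends on \<open>\<alpha>\<close> only and becomes the factor
  \<open>g\<close> of the generating functional. The base is taken as \<open>d = 1\<close>, which
  removes the term with \<open>weighted_sum\<close> and leaves \<open>pair_sum\<close>. The bound on
  \<open>F\<close> is read off the representation by \<open>inar_cumulant\<close>, where
  \<open>g\<close> has modulus 1 and the exponent has nonpositive real part; it is not visible in
  the formula for \<open>F\<close>.\<close>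

lemma characteristic_function_weighted_inar:
  fixes u :: "int \<Rightarrow> real" and N :: nat
  defines "F \<equiv> \<lambda>a. exp (of_real (lam / (1 - a)) * (pair_sum u a (int N) - \<i> * of_real (\<Sum>k=1..int N. u k)))"
  shows "(LINT w|M. iexp (\<Sum>k=1..N. u (int k) * (real (X k w) - lam / (1 - \<alpha> w)))) = (LINT w|M. F (\<alpha> w))"
    and "a \<in> {0<..<1} \<Longrightarrow> norm (F a) \<le> 1"
proof -
  let ?c = "\<lambda>j. iexp (u (int j))"
  define s where "s = (\<Sum>k=1..N. u (int k))"
  have s: "(\<Sum>k=1..int N. u k) = s"
    unfolding s_def
    by (rule sum.reindex_bij_witness[where i = int and j = nat]) auto
  define g where "g a = iexp (- (lam / (1 - a) * s))" for a
  have g_meas [measurable]: "g \<in> borel_measurable borel"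
    unfolding g_def by measurable
  have F_eq: "g a * exp (of_real lam * inar_cumulant ?c N a 1) = F a" if "a \<in> {0<..<1}" for a
  proof -
    have "of_real (1 - a) * inar_cumulant ?c N a 1 = pair_sum u a (int N)"
      using inar_cumulant_eq[of a u N 1] that by simp
    moreover have "complex_of_real (1 - a) \<noteq> 0" using that by simp
    ultimately have "inar_cumulant ?c N a 1 = pair_sum u a (int N) / of_real (1 - a)"
      by (metis nonzero_mult_div_cancel_left)
    then show ?thesis
      unfolding g_def F_def exp_add[symmetric] s by (simp add: diff_divide_distrib algebra_simps)
  qed
  have "iexp (\<Sum>k=1..N. u (int k) * (real (X k w) - lam / (1 - \<alpha> w)))
      = g (\<alpha> w) * (\<Prod>j=1..N. ?c j ^ X j w) * 1 ^ X N w" for w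
  proof -
    have "(\<Sum>k=1..N. u (int k) * (real (X k w) - lam / (1 - \<alpha> w)))
        = - (lam / (1 - \<alpha> w) * s) + (\<Sum>k=1..N. real (X k w) * u (int k))"
      by (simp add: s_def sum_distrib_left right_diff_distrib sum_subtractf mult.commute)
    moreover have "(\<Prod>j=1..N. ?c j ^ X j w) = iexp (\<Sum>k=1..N. real (X k w) * u (int k))"
      by (simp add: exp_of_nat_mult[symmetric] exp_sum[symmetric] sum_distrib_left mult_ac)
    ultimately show ?thesis
      by (simp add: g_def exp_add[symmetric] ring_distribs)
  qed
  then have "(LINT w|M. iexp (\<Sum>k=1..N. u (int k) * (real (X k w) - lam / (1 - \<alpha> w))))
      = (LINT w|M. g (\<alpha> w) * (\<Prod>j=1..N. ?c j ^ X j w) * 1 ^ X N w)"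
    by (simp only:)
  also have "\<dots> = (LINT w|M. g (\<alpha> w) * exp (of_real lam * inar_cumulant ?c N (\<alpha> w) 1))"
    by (rule integral_inar_generating_functional[where C = 1]) (auto simp: g_def)
  also have "\<dots> = (LINT w|M. F (\<alpha> w))"
    by (intro Bochner_Integration.integral_cong refl F_eq alpha_range)
  finally show "(LINT w|M. iexp (\<Sum>k=1..N. u (int k) * (real (X k w) - lam / (1 - \<alpha> w)))) = (LINT w|M. F (\<alpha> w))" .
  show "norm (F a) \<le> 1" if a: "a \<in> {0<..<1}"
  proof -
    have "Re (inar_cumulant ?c N a 1) \<le> 0"
      by (intro Re_inar_cumulant_nonpos a) auto
    then show ?thesis
      using lam_pos unfolding F_eq[OF a, symmetric]
      by (simp add: g_def norm_mult mult_nonneg_nonpos)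
  qed
qed

end

theorem proposition1p3:
  fixes M :: "'w measure"
    and lam \<beta> \<psi>1 :: real
    and \<psi> :: "real \<Rightarrow> real"
    and \<alpha> :: "'w \<Rightarrow> real"
    and X0 :: "'w \<Rightarrow> nat"
    and \<xi> :: "nat \<Rightarrow> nat \<Rightarrow> 'w \<Rightarrow> nat"
    and \<epsilon> :: "nat \<Rightarrow> 'w \<Rightarrow> nat"
    and n m :: nat
    and t \<theta> :: "nat \<Rightarrow> real"
  assumes "randomized_poisson_inar1 M lam \<beta> \<psi>1 \<psi> \<alpha> X0 \<xi> \<epsilon>"
    and "1 \<le> n" and "1 \<le> m"
    and "t 0 = 0" and "\<And>l. l < m \<Longrightarrow> t l < t (Suc l)"
  shows
    "set_integrable lborel {0<..<1}
       (\<lambda>a. exp (of_real (lam / (1 - a)) * K_fun n m t \<theta> a) * of_real (\<psi> a * (1 - a) powr \<beta>)) \<and>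
     (LINT w|M. iexp (\<Sum>l=1..m. \<theta> l * S1 lam \<alpha> X0 \<xi> \<epsilon> n (t l) w))
       = (LINT a:{0<..<1}|lborel.
            exp (of_real (lam / (1 - a)) * K_fun n m t \<theta> a) * of_real (\<psi> a * (1 - a) powr \<beta>)) \<and>
     (\<forall>a\<in>{0..<1}. Ktilde_term n m t \<theta> a summable_on {..fl n t m} \<and>
        Ktilde n m t \<theta> a = Ktilde_closed n m t \<theta> a) \<and>
     set_integrable lborel {0<..<1}
       (\<lambda>a. exp (of_real lam * Ktilde n m t \<theta> a) * of_real (\<psi> a * (1 - a) powr \<beta>)) \<and>
     (LINT w|M. iexp (\<Sum>l=1..m. \<theta> l * S1 lam \<alpha> X0 \<xi> \<epsilon> n (t l) w))
       = (LINT a:{0<..<1}|lborel.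
            exp (of_real lam * Ktilde n m t \<theta> a) * of_real (\<psi> a * (1 - a) powr \<beta>))"
proof -
  interpret randomized_poisson_inar1 M lam \<beta> \<psi>1 \<psi> \<alpha> X0 \<xi> \<epsilon>
    by fact
  note t = \<open>t 0 = 0\<close> \<open>\<And>l. l < m \<Longrightarrow> t l < t (Suc l)\<close>
  let ?u = "theta_tilde n m t \<theta>" and ?p = "\<lambda>a. complex_of_real (\<psi> a * (1 - a) powr \<beta>)"
  define N where "N = nat (fl n t m)"
  have N: "int N = fl n t m"
    unfolding N_def using fl_nonneg[OF t] by simp
  let ?F = "\<lambda>a. exp (of_real (lam / (1 - a)) * (pair_sum ?u a (int N) - \<i> * of_real (\<Sum>k=1..int N. ?u k)))"
  have K: "K_fun n m t \<theta> a = pair_sum ?u a (int N) - \<i> * of_real (\<Sum>k=1..int N. ?u k)" for a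
    unfolding N by (rule K_fun_eq[OF t])
  have Ktilde: "Ktilde_term n m t \<theta> a summable_on {..fl n t m} \<and>
      Ktilde n m t \<theta> a = Ktilde_closed n m t \<theta> a" if "a \<in> {0..<1}" for a
  proof -
    have "(Ktilde_term n m t \<theta> a has_sum Ktilde_closed n m t \<theta> a) {..fl n t m}"
      using that fl_nonneg[OF t] by (intro Ktilde_term_has_sum) auto
    then show ?thesis
      unfolding Ktilde_def using has_sum_imp_summable infsumI by blast
  qed
  have Ktilde_F: "exp (of_real lam * Ktilde n m t \<theta> a) = ?F a" if "a \<in> {0<..<1}" for a
  proof -
    have "of_real (1 - a) * Ktilde n m t \<theta> a = pair_sum ?u a (int N) - \<i> * of_real (\<Sum>k=1..int N. ?u k)"
      using that Ktilde[of a] path_sum_eq_pair_sum[OF of_nat_0_le_iff, of a ?u N]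
      by (simp add: Ktilde_closed_eq_path_sum N)
    moreover have "of_real (lam / (1 - a)) * (of_real (1 - a) * Ktilde n m t \<theta> a)
        = of_real lam * Ktilde n m t \<theta> a"
      using that by (simp only: mult.assoc[symmetric] of_real_mult[symmetric]) simp
    ultimately show ?thesis by (simp only:)
  qed
  note char = characteristic_function_weighted_inar[where u = ?u and N = N]
  have F_meas: "?F \<in> borel_measurable borel" by measurable
  note int = integral_alpha[OF F_meas char(2)]
  have main: "(LINT w|M. iexp (\<Sum>l=1..m. \<theta> l * S1 lam \<alpha> X0 \<xi> \<epsilon> n (t l) w))
      = (LINT a:{0<..<1}|lborel. ?F a * ?p a)"
    by (simp only: sum_S1_eq[OF t] N_def[symmetric] char(1) int(2))
  \<comment> \<open>On the open unit interval the integrand agrees with that of \<open>?F\<close>,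
    so integrability and value are transferred by congruence. This avoids a measurability argument
    for the infinite sum in \<open>Ktilde\<close>.\<close>
  have "set_integrable lborel {0<..<1} (\<lambda>a. exp (of_real lam * Ktilde n m t \<theta> a) * ?p a)
      \<longleftrightarrow> set_integrable lborel {0<..<1} (\<lambda>a. ?F a * ?p a)"
    by (rule set_integrable_cong) (simp_all only: Ktilde_F)
  moreover have "(LINT a:{0<..<1}|lborel. exp (of_real lam * Ktilde n m t \<theta> a) * ?p a)
      = (LINT a:{0<..<1}|lborel. ?F a * ?p a)"
    by (rule set_lebesgue_integral_cong) (simp, auto simp only: Ktilde_F)
  ultimately show ?thesis
    unfolding K using Ktilde main int(1) by simp
qed

end
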